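(* For each $n$ consider the random intersection graph with communities $\mathrm{RIGC}(\boldsymbol d^{l},\mathbf{Com})$, under conditions (A)–(D) of the context. Then the single-overlap property holds in the following ways. (i) (Vertex perspective) Let $V_n^l$ be uniform on the set of individuals $[N_n]$, independent of the random matching $\omega_n$. As $n\to\infty$, $$\mathbb P\big(\exists\{a,b\}\in\mathscr L_2:\ V_n^l\text{ is part of } a\text{ and of } b\ \big|\ \omega_n\big)\xrightarrow{\ \mathbb P\ }0.$$ (ii) (Group perspective) Let $V_n^r$ be uniform on the set of communities $[M_n]$, independent of $\omega_n$. As $n\to\infty$, $$\mathbb P\big(\exists b\in\mathscr N(V_n^r):\ \mathscr O(V_n^r,b)\ge2\ \big|\ \omega_n\big)\xrightarrow{\ \mathbb P\ }0.$$ (iii) (Global perspective) Assume additionally that $\mathbb E[(D_n^l)^2]\to\mathbb E[(D^l)^2]<\infty$ as $n\to\infty$, and, given $\omega_n$, let $\{A_n,B_n\}$ be chosen uniformly at random from $\mathscr L_1$. Then, as $n\to\infty$, $$\mathbb P\big(\mathscr O(A_n,B_n)\ge2\ \big|\ \omega_n\big)=|\mathscr L_2|\big/|\mathscr L_1|\xrightarrow{\ \mathbb P\ }0.$$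
   Context: **Model.** For each $n$: individuals $\mathscr V^{l}=[N_n]$ and communities $\mathscr V^{r}=[M_n]$ (treated as disjoint sets), with $N_n,M_n\to\infty$. Each individual $v$ has a number of memberships ($l$-degree) $d^{l}_v\ge 1$. Let $\mathscr H$ be the set of non-empty, simple, finite, connected graphs, one representative per isomorphism class, with $H\in\mathscr H$ having vertex set $[|H|]$. Each community $a$ has a community graph $\mathrm{Com}_a\in\mathscr H$, and $r$-degree $d^{r}_a=|\mathrm{Com}_a|\ge1$. Assume $h_n:=\sum_{v}d^{l}_v=\sum_a d^{r}_a$. Individual $v$ has $l$-half-edges $(v,i)$, $i\in[d^l_v]$; community $a$ has $r$-half-edges $(a,k)$, $k\in[d^r_a]$, the half-edge $(a,k)$ representing the vertex of $\mathrm{Com}_a$ labelled $k$ (a "community role"). Let $\omega_n$ be a uniformly random bijection between $l$-half-edges and $r$-half-edges. If $(v,i)$ is matched to $(a,k)$ we say $v$ takes the role $j=(a,k)$. $\mathrm{RIGC}(\boldsymbol d^l,\mathbf{Com})$ is the random multigraph on $\mathscr V^l$ obtained by adding, for every community $a$ and every edge $\{j_1,j_2\}$ of $\mathrm{Com}_a$, one edge between the individuals taking roles $j_1$ and $j_2$. **Overlaps.** Individual $v$ is part of community $a$ if $v$ takes at least one role of $\mathrm{Com}_a$. For communities $a\ne b$, the overlap size $\mathscr O(a,b)$ is the number of individuals that are part of both $a$ and $b$. $\mathscr N(a)=\{b\in[M_n]: b\ne a,\ \mathscr O(a,b)\ge1\}$. For $k\ge1$, $\mathscr L_k$ is the set of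 unordered pairs $\{a,b\}$ of distinct communities with $\mathscr O(a,b)\ge k$. **Assumptions.** Let $D_n^l=d^l_{V}$ with $V$ uniform on $[N_n]$, $D_n^r=d^r_{A}$ with $A$ uniform on $[M_n]$, and $\mu^{(n)}_H=|\{a:\mathrm{Com}_a=H\}|/M_n$ for $H\in\mathscr H$. (A) $D_n^l$ converges in distribution to a random variable $D^l$. (B) $\mathbb E[D_n^l]\to\mathbb E[D^l]<\infty$. (C) There is a probability mass function $\mu$ on $\mathscr H$ with $\mu_H^{(n)}\to\mu_H$ for all $H$; consequently $D_n^r$ converges in distribution to $D^r$ with pmf $q_k=\sum_{|H|=k}\mu_H$. (D) $\mathbb E[D_n^r]\to\mathbb E[D^r]<\infty$. *)

theory Defs
  imports "HOL-Probability.Probability" "Graph_Theory.Graph_Theory"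
begin

text \<open>
  A simple graph is a \<open>pair_graph\<close>: a finite, symmetric and loop-free set of arcs, every edge
  \<open>{u, v}\<close> being represented by the two arcs \<open>(u, v)\<close> and \<open>(v, u)\<close>.  The name \<open>connected\<close> is
  qualified because it also denotes topological connectedness.
\<close>

definition simple_connected_graph :: "nat pair_pre_digraph \<Rightarrow> bool" where
  "simple_connected_graph H \<longleftrightarrow>
     pverts H \<noteq> {} \<and> pair_graph H \<and> Digraph_Component.connected (with_proj H)"

definition edges :: "nat pair_pre_digraph \<Rightarrow> nat set set" where
  "edges H = {{u, v} | u v. (u, v) \<in> parcs H}"

definition gsize :: "nat pair_pre_digraph \<Rightarrow> nat" where
  "gsize H = card (pverts H)"

text \<open>Every finite graph has an isomorphic copy on natural numbers, so it suffices to represent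
  the isomorphism classes of graphs with vertices in \<open>nat\<close>.\<close>

definition class_representatives :: "nat pair_pre_digraph set \<Rightarrow> bool" where
  "class_representatives \<H> \<longleftrightarrow>
     (\<forall>H\<in>\<H>. simple_connected_graph H \<and> pverts H = {1..gsize H}) \<and>
     (\<forall>G. simple_connected_graph G \<longrightarrow>
        (\<exists>!H. H \<in> \<H> \<and> digraph_iso (with_proj G) (with_proj H)))"

text \<open>The parameters of one random intersection graph with communities.  Individuals and
  communities are both numbered from \<open>1\<close>; they never occur in a common set.\<close>

record rigc_params =
  num_l :: nat                                  \<comment> \<open>number of individuals\<close>
  num_r :: nat                                  \<comment> \<open>number of communities\<close>
  ldeg :: "nat \<Rightarrow> nat"                            \<comment> \<open>numbers of memberships\<close>
  com :: "nat \<Rightarrow> nat pair_pre_digraph"            \<comment> \<open>community graphs\<close>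

definition individuals :: "rigc_params \<Rightarrow> nat set" where
  "individuals R = {1..num_l R}"

definition communities :: "rigc_params \<Rightarrow> nat set" where
  "communities R = {1..num_r R}"

definition rdeg :: "rigc_params \<Rightarrow> nat \<Rightarrow> nat" where
  "rdeg R a = gsize (com R a)"

definition valid_params :: "nat pair_pre_digraph set \<Rightarrow> rigc_params \<Rightarrow> bool" where
  "valid_params \<H> R \<longleftrightarrow>
     (\<forall>v\<in>individuals R. ldeg R v \<ge> 1) \<and>
     (\<forall>a\<in>communities R. com R a \<in> \<H>) \<and>
     (\<Sum>v\<in>individuals R. ldeg R v) = (\<Sum>a\<in>communities R. rdeg R a)"

definition l_half_edges :: "rigc_params \<Rightarrow> (nat \<times> nat) set" where
  "l_half_edges R = (SIGMA v:individuals R. {1..ldeg R v})"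

definition r_half_edges :: "rigc_params \<Rightarrow> (nat \<times> nat) set" where
  "r_half_edges R = (SIGMA a:communities R. {1..rdeg R a})"

type_synonym matching = "nat \<times> nat \<Rightarrow> nat \<times> nat"

text \<open>Bijections are taken extensional (\<open>undefined\<close> off the \<open>l\<close>-half-edges), so that each one is
  counted once.\<close>

definition matchings :: "rigc_params \<Rightarrow> matching set" where
  "matchings R =
     {\<omega> \<in> l_half_edges R \<rightarrow>\<^sub>E r_half_edges R. bij_betw \<omega> (l_half_edges R) (r_half_edges R)}"

definition random_matching :: "rigc_params \<Rightarrow> matching pmf" where
  "random_matching R = pmf_of_set (matchings R)"

definition takes_role :: "rigc_params \<Rightarrow> matching \<Rightarrow> nat \<Rightarrow> nat \<times> nat \<Rightarrow> bool" where
  "takes_role R \<omega> v j \<longleftrightarrow> v \<in> individuals R \<and> (\<exists>i\<in>{1..ldeg R v}. \<omega> (v, i) = j)"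

text \<open>The multigraph on the individuals that a matching induces, given by its multiset of edges.
  The edge \<open>{k\<^sub>1, k\<^sub>2}\<close> of the graph of community \<open>a\<close> contributes the set of the individuals taking the
  roles \<open>(a, k\<^sub>1)\<close> and \<open>(a, k\<^sub>2)\<close>, which is a singleton when this edge is a loop.  The overlaps below
  are functions of the matching, not of this multigraph.\<close>

definition rigc_edges :: "rigc_params \<Rightarrow> matching \<Rightarrow> nat set multiset" where
  "rigc_edges R \<omega> =
     image_mset (\<lambda>(a, e). {v. \<exists>k\<in>e. takes_role R \<omega> v (a, k)})
       (mset_set (SIGMA a:communities R. edges (com R a)))"

definition rigc :: "rigc_params \<Rightarrow> nat set multiset pmf" where
  "rigc R = map_pmf (rigc_edges R) (random_matching R)"

definition part_of :: "rigc_params \<Rightarrow> matching \<Rightarrow> nat \<Rightarrow> nat \<Rightarrow> bool" where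
  "part_of R \<omega> v a \<longleftrightarrow> (\<exists>k\<in>{1..rdeg R a}. takes_role R \<omega> v (a, k))"

definition overlap :: "rigc_params \<Rightarrow> matching \<Rightarrow> nat \<Rightarrow> nat \<Rightarrow> nat" where
  "overlap R \<omega> a b = card {v \<in> individuals R. part_of R \<omega> v a \<and> part_of R \<omega> v b}"

definition nbr_communities :: "rigc_params \<Rightarrow> matching \<Rightarrow> nat \<Rightarrow> nat set" where
  "nbr_communities R \<omega> a = {b \<in> communities R. b \<noteq> a \<and> overlap R \<omega> a b \<ge> 1}"

definition overlapping_pairs :: "rigc_params \<Rightarrow> matching \<Rightarrow> nat \<Rightarrow> nat set set" where
  "overlapping_pairs R \<omega> k =
     {{a, b} | a b. a \<in> communities R \<and> b \<in> communities R \<and> a \<noteq> b \<and> overlap R \<omega> a b \<ge> k}"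

text \<open>Joint laws of a uniform individual, a uniform community, and a uniform pair of overlapping
  communities with the random matching.  If no two communities overlap, no pair can be drawn,
  which is recorded as \<open>None\<close>.\<close>

definition individual_matching :: "rigc_params \<Rightarrow> (nat \<times> matching) pmf" where
  "individual_matching R = pair_pmf (pmf_of_set (individuals R)) (random_matching R)"

definition community_matching :: "rigc_params \<Rightarrow> (nat \<times> matching) pmf" where
  "community_matching R = pair_pmf (pmf_of_set (communities R)) (random_matching R)"

definition random_overlapping_pair :: "rigc_params \<Rightarrow> matching \<Rightarrow> nat set option pmf" where
  "random_overlapping_pair R \<omega> =
     (if overlapping_pairs R \<omega> 1 = {} then return_pmf None
      else map_pmf Some (pmf_of_set (overlapping_pairs R \<omega> 1)))"

definition pair_matching :: "rigc_params \<Rightarrow> (nat set option \<times> matching) pmf" where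
  "pair_matching R =
     bind_pmf (random_matching R) (\<lambda>\<omega>. map_pmf (\<lambda>p. (p, \<omega>)) (random_overlapping_pair R \<omega>))"

text \<open>Conditional probabilities of the three events given that the matching is \<open>w\<close>.\<close>

definition vertex_prob :: "rigc_params \<Rightarrow> matching \<Rightarrow> real" where
  "vertex_prob R w =
     \<P>((v, \<omega>) in individual_matching R.
        (\<exists>a b. {a, b} \<in> overlapping_pairs R \<omega> 2 \<and> part_of R \<omega> v a \<and> part_of R \<omega> v b) \<bar> \<omega> = w)"

definition group_prob :: "rigc_params \<Rightarrow> matching \<Rightarrow> real" where
  "group_prob R w =
     \<P>((a, \<omega>) in community_matching R.
        (\<exists>b\<in>nbr_communities R \<omega> a. overlap R \<omega> a b \<ge> 2) \<bar> \<omega> = w)"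

definition global_prob :: "rigc_params \<Rightarrow> matching \<Rightarrow> real" where
  "global_prob R w =
     \<P>((p, \<omega>) in pair_matching R.
        (\<exists>a b. p = Some {a, b} \<and> overlap R \<omega> a b \<ge> 2) \<bar> \<omega> = w)"

text \<open>Convergence in probability to a constant; the random variables may live on different
  probability spaces.\<close>

definition tendsto_in_prob :: "(nat \<Rightarrow> 'a pmf) \<Rightarrow> (nat \<Rightarrow> 'a \<Rightarrow> real) \<Rightarrow> real \<Rightarrow> bool" where
  "tendsto_in_prob \<Omega> X c \<longleftrightarrow>
     (\<forall>\<epsilon>>0. (\<lambda>n. \<P>(\<omega> in \<Omega> n. \<bar>X n \<omega> - c\<bar> > \<epsilon>)) \<longlonglongrightarrow> 0)"

end

theory Submission
  imports Defs "HOL-Real_Asymp.Real_Asymp"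
begin

text \<open>
  Call two distinct half-edges of one individual siblings; the matching sends each ordered sibling
  pair to an ordered pair of communities.  An overlap of size at least two makes two sibling pairs
  collide, that is, land on the same pair of communities.  If all degrees involved are at most
  \<open>D\<close> and \<open>K\<close>, then among the at most \<open>h D\<close> sibling pairs only \<open>O(1)\<close> collisions are expected,
  because matching \<open>k\<close> given half-edges in a prescribed way has probability \<open>O(1/h^k)\<close>.  The half-edges
  at vertices of larger degree form a small fraction, by uniform integrability, and so spoil few
  individuals and few communities; this gives the vertex and the group perspective.

  For the global perspective let \<open>S\<close> be the number of all ordered sibling pairs.  The second moment
  assumption gives \<open>S = O(h)\<close> and maximal individual degree \<open>O(sqrt h)\<close>, so the expected number of
  sibling pairs that collide or land on a community of size above \<open>K\<close> or twice on one community
  is a small fraction of \<open>S\<close>.  Outside an event of small probability \<open>|L\<^sub>2|\<close> is therefore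
  small compared with \<open>S\<close>, whereas \<open>|L\<^sub>1| \<ge> S / 4\<close>.  Comparing with \<open>S\<close> instead of \<open>h\<close> also covers
  the case that almost all individuals have only one membership.
\<close>

section \<open>Uniform random bijections\<close>

definition bijections :: "'a set \<Rightarrow> 'b set \<Rightarrow> ('a \<Rightarrow> 'b) set" where
  "bijections A B = {f \<in> A \<rightarrow>\<^sub>E B. bij_betw f A B}"

lemma bijections_eq_inj:
  assumes "finite B" "card A = card B"
  shows "bijections A B = {f \<in> A \<rightarrow>\<^sub>E B. inj_on f A}"
proof -
  have "bij_betw f A B" if "f \<in> A \<rightarrow>\<^sub>E B" "inj_on f A" for f
    using that assms card_subset_eq[of B "f ` A"] by (auto simp: bij_betw_def card_image)
  then show ?thesis
    by (auto simp: bijections_def bij_betw_def)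
qed

lemma finite_bijections: "finite A \<Longrightarrow> finite B \<Longrightarrow> finite (bijections A B)"
  unfolding bijections_def by (rule finite_subset[OF _ finite_PiE[of A "\<lambda>_. B"]]) auto

lemma card_bijections:
  assumes "finite A" "finite B" "card A = card B"
  shows "card (bijections A B) = fact (card A)"
  using card_inj_on_subset_funcset[OF assms(1,2) order.refl] assms
  by (simp add: bijections_eq_inj fact_prod_rev)

lemma bijections_nonempty:
  assumes "finite A" "finite B" "card A = card B"
  shows "bijections A B \<noteq> {}"
  using card_bijections[OF assms] by (metis card.empty fact_nonzero)

text \<open>A bijection with prescribed values on \<open>ps\<close> is determined by its restriction
  to \<open>A - set ps\<close>, a bijection onto the values left over. For an inadmissible list
  \<open>rs\<close> no such bijection exists, hence an inequality.\<close>

lemma card_bijections_map_eq_le: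
  assumes fin: "finite A" "finite B" and card: "card A = card B"
    and ps: "distinct ps" "set ps \<subseteq> A"
  shows "card (bijections A B \<inter> {f. map f ps = rs}) \<le> fact (card A - length ps)"
proof (cases "bijections A B \<inter> {f. map f ps = rs} = {}")
  case False
  let ?X = "bijections A B \<inter> {f. map f ps = rs}"
  \<comment> \<open>Any member of the set certifies that \<open>rs\<close> is distinct, lies in
    \<open>B\<close> and has the length of \<open>ps\<close>.\<close>
  from False obtain g where "g \<in> bijections A B" "map g ps = rs" by auto
  then have rs: "distinct rs" "set rs \<subseteq> B" "length rs = length ps"
    using ps image_mono[of "set ps" A g]
    by (auto simp: bijections_def distinct_map bij_betw_def intro: inj_on_subset)
  have cA: "card (A - set ps) = card A - length ps"
    using fin ps by (simp add: card_Diff_subset distinct_card)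
  have cB: "card (B - set rs) = card A - length ps"
    using fin rs card by (simp add: card_Diff_subset distinct_card)
  have "card ?X \<le> card (bijections (A - set ps) (B - set rs))"
  proof (rule card_inj_on_le[where f = "\<lambda>f. restrict f (A - set ps)"])
    show "inj_on (\<lambda>f. restrict f (A - set ps)) ?X"
    proof (rule inj_onI)
      fix f f' assume f: "f \<in> ?X" "f' \<in> ?X"
        and eq: "restrict f (A - set ps) = restrict f' (A - set ps)"
      have "f x = f' x" if "x \<in> A" for x
      proof (cases "x \<in> set ps")
        case True
        from f have "map f ps = map f' ps" by simp
        then show ?thesis using True by (simp add: map_eq_conv)
      next
        case False
        then show ?thesis using fun_cong[OF eq, of x] that by simp
      qed
      then show "f = f'"
        using f by (auto simp: bijections_def intro: PiE_ext)
    qed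
    show "(\<lambda>f. restrict f (A - set ps)) ` ?X \<subseteq> bijections (A - set ps) (B - set rs)"
    proof (rule image_subsetI)
      fix f assume f: "f \<in> ?X"
      then have "bij_betw f A B" "map f ps = rs" by (auto simp: bijections_def)
      moreover have "f ` set ps = set rs"
        using \<open>map f ps = rs\<close> by auto
      ultimately have "bij_betw f (A - set ps) (B - set rs)"
        using ps by (auto simp: bij_betw_def inj_on_image_set_diff[of f A] inj_on_diff)
      then have "bij_betw (restrict f (A - set ps)) (A - set ps) (B - set rs)"
        by (subst bij_betw_cong[of _ _ f]) auto
      then show "restrict f (A - set ps) \<in> bijections (A - set ps) (B - set rs)"
        by (auto simp: bijections_def bij_betw_def)
    qed
    show "finite (bijections (A - set ps) (B - set rs))"
      using fin by (simp add: finite_bijections)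
  qed
  also have "\<dots> = fact (card A - length ps)"
    using card_bijections[of "A - set ps" "B - set rs"] fin cA cB by simp
  finally show ?thesis .
qed (use fin in \<open>auto simp: Suc_le_eq\<close>)

text \<open>The quotient is a product of at most four factors \<open>1 / (n - i)\<close> with
  \<open>i \<le> 3\<close>, and \<open>n - i\<close> is at least \<open>n / 2\<close> from
  \<open>n = 6\<close> on. Four is the number of half-edges in two disjoint sibling pairs.\<close>

lemma fact_ratio_le:
  assumes "k \<le> 4" "6 \<le> n"
  shows "fact (n - k) / fact n \<le> (2 / real n) ^ k"
  using assms(1)
proof (induction k)
  case (Suc k)
  have eq: "fact (n - k) = real (n - k) * fact (n - Suc k)"
    using Suc.prems assms(2) by (subst fact_reduce) (auto simp: of_nat_diff)
  have k: "real (n - k) \<ge> real n / 2"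
    using Suc.prems assms(2) by linarith
  have "fact (n - Suc k) / fact n = fact (n - k) / fact n * (1 / real (n - k))"
    using k assms(2) by (simp add: eq)
  also have "\<dots> \<le> (2 / real n) ^ k * (2 / real n)"
    using k assms(2) Suc by (intro mult_mono) (auto simp: field_simps)
  finally show ?case by (simp add: mult_ac)
qed simp

context
  fixes A :: "'a set" and B :: "'b set"
  assumes fin: "finite A" "finite B" and card_eq: "card A = card B" and card_ge: "6 \<le> card A"
begin

text \<open>Union bound over the value lists in \<open>E\<close>. The separate constant
  \<open>c\<close> is convenient because \<open>E\<close> will be an image whose size is only
  estimated from above.\<close>

lemma prob_map_in_le:
  assumes ps: "distinct ps" "set ps \<subseteq> A" "length ps \<le> 4" and E: "finite E"
    "real (card E) \<le> c"
  shows "measure_pmf.prob (pmf_of_set (bijections A B)) {f. map f ps \<in> E}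
           \<le> c * (2 / real (card A)) ^ length ps"
proof -
  let ?P = "measure_pmf.prob (pmf_of_set (bijections A B))"
  have "?P {f. map f ps = rs} \<le> (2 / real (card A)) ^ length ps" for rs
  proof -
    have "?P {f. map f ps = rs} =
        real (card (bijections A B \<inter> {f. map f ps = rs})) / fact (card A)"
      by (subst measure_pmf_of_set[OF bijections_nonempty[OF fin card_eq] finite_bijections[OF fin]])
         (simp only: card_bijections[OF fin card_eq] of_nat_fact)
    also have "\<dots> \<le> real (fact (card A - length ps)) / fact (card A)"
      using card_bijections_map_eq_le[OF fin card_eq ps(1,2), of rs]
      by (intro divide_right_mono of_nat_mono) auto
    also have "\<dots> \<le> (2 / real (card A)) ^ length ps"
      using fact_ratio_le[OF ps(3) card_ge] by simp
    finally show ?thesis .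
  qed
  note single = this
  have "{f. map f ps \<in> E} = (\<Union>rs\<in>E. {f. map f ps = rs})" by auto
  then have "?P {f. map f ps \<in> E} \<le> (\<Sum>rs\<in>E. ?P {f. map f ps = rs})"
    using E(1) by (simp add: measure_pmf.finite_measure_subadditive_finite)
  also have "\<dots> \<le> real (card E) * (2 / real (card A)) ^ length ps"
    using sum_bounded_above[of E "\<lambda>rs. ?P {f. map f ps = rs}", OF single] by simp
  also have "\<dots> \<le> c * (2 / real (card A)) ^ length ps"
    using E(2) by (intro mult_right_mono) auto
  finally show ?thesis .
qed

end

text \<open>Markov's inequality for a count, whose expectation is the sum of the probabilities of
  the single events.\<close>

lemma prob_card_ge_le:
  fixes p :: "'a pmf"
  assumes C: "finite C" and t: "0 < t"
  shows "measure_pmf.prob p {x. t \<le> real (card {c \<in> C. Q c x})}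
           \<le> (\<Sum>c\<in>C. measure_pmf.prob p {x. Q c x}) / t"
proof -
  have eq: "real (card {c \<in> C. Q c x}) = (\<Sum>c\<in>C. indicator {x. Q c x} x)" for x
    using C by (simp add: indicator_def sum.If_cases Int_def)
  have int: "integrable (measure_pmf p) (\<lambda>x. \<Sum>c\<in>C. indicat_real {x. Q c x} x)"
    by (intro Bochner_Integration.integrable_sum measure_pmf.integrable_const_bound[where B=1]) auto
  have "measure_pmf.prob p {x \<in> space (measure_pmf p). t \<le> (\<Sum>c\<in>C. indicat_real {x. Q c x} x)}
      \<le> (\<integral>x. (\<Sum>c\<in>C. indicat_real {x. Q c x} x) \<partial>measure_pmf p) / t"
    by (rule integral_Markov_inequality_measure[OF int, where A = "{}"])
       (auto simp: t sum_nonneg)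
  also have "(\<integral>x. (\<Sum>c\<in>C. indicat_real {x. Q c x} x) \<partial>measure_pmf p)
      = (\<Sum>c\<in>C. measure_pmf.prob p {x. Q c x})"
    by (subst Bochner_Integration.integral_sum) (auto intro: measure_pmf.integrable_const_bound[where B=1])
  finally show ?thesis by (simp add: eq)
qed

text \<open>One representative is kept in every fibre of \<open>f\<close>, and these are as many as
  the values of \<open>f\<close>. Every other element collides with its representative.\<close>

lemma card_le_image_add_collisions:
  assumes "finite G"
  shows "card G \<le> card (f ` G) + card {(c, c'). c \<in> G \<and> c' \<in> G \<and> c \<noteq> c' \<and> f c = f c'}"
proof -
  let ?T = "{(c, c'). c \<in> G \<and> c' \<in> G \<and> c \<noteq> c' \<and> f c = f c'}"
  let ?g = "\<lambda>c. inv_into G f (f c)"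
  have fT: "finite ?T"
    by (rule finite_subset[of _ "G \<times> G"]) (use assms in auto)
  have "card G \<le> card (?g ` G \<union> (G - ?g ` G))"
    using assms by (intro card_mono) auto
  also have "\<dots> \<le> card (?g ` G) + card (G - ?g ` G)"
    by (rule card_Un_le)
  also have "card (?g ` G) \<le> card (f ` G)"
    using assms card_image_le[of "f ` G" "inv_into G f"] by (simp add: image_image)
  also have "card (G - ?g ` G) \<le> card ?T"
  proof (rule card_inj_on_le[OF _ _ fT])
    show "inj_on (\<lambda>c. (c, ?g c)) (G - ?g ` G)" by (auto intro: inj_onI)
    show "(\<lambda>c. (c, ?g c)) ` (G - ?g ` G) \<subseteq> ?T"
      by (auto simp: f_inv_into_f inv_into_into)
  qed
  finally show ?thesis by simp
qed

text \<open>The matching is drawn first and \<open>x\<close> then by the kernel \<open>k\<close>.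
  Numerator and denominator of the conditional probability share the factor \<open>pmf q w\<close>,
  which is nonzero on the support and cancels.\<close>

lemma cond_prob_bind_pmf:
  assumes "w \<in> set_pmf q"
  shows "\<P>((x, \<omega>) in measure_pmf (bind_pmf q (\<lambda>\<omega>. map_pmf (\<lambda>x. (x, \<omega>)) (k \<omega>))). E x \<omega> \<bar> \<omega> = w)
           = measure_pmf.prob (k w) {x. E x w}"
proof -
  let ?J = "bind_pmf q (\<lambda>\<omega>. map_pmf (\<lambda>x. (x, \<omega>)) (k \<omega>))"
  have *: "measure_pmf.prob ?J {z. F (fst z) (snd z) \<and> snd z = w}
      = pmf q w * measure_pmf.prob (k w) {x. F x w}" for F
  proof -
    have "emeasure (measure_pmf ?J) {z. F (fst z) (snd z) \<and> snd z = w}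
        = (\<integral>\<^sup>+\<omega>. emeasure (measure_pmf (k w)) {x. F x w} * indicator {w} \<omega> \<partial>measure_pmf q)"
      by (auto intro!: nn_integral_cong simp: indicator_def vimage_def)
    also have "\<dots> = emeasure (measure_pmf (k w)) {x. F x w} * pmf q w"
      by (simp add: nn_integral_cmult_indicator emeasure_pmf_single)
    finally show ?thesis
      by (simp add: measure_pmf.emeasure_eq_measure mult.commute flip: ennreal_mult'')
  qed
  show ?thesis
    using *[of E] *[of "\<lambda>_ _. True"] assms
    by (simp add: cond_prob_def case_prod_unfold set_pmf_iff)
qed

text \<open>Puts an independent pair into the form that \<open>cond_prob_bind_pmf\<close> expects,
  with a constant kernel.\<close>

lemma pair_pmf_eq_bind_map:
  "pair_pmf A B = bind_pmf B (\<lambda>y. map_pmf (\<lambda>x. (x, y)) A)"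
  unfolding pair_pmf_def map_pmf_def by (rule bind_commute_pmf)

section \<open>Overlaps in terms of half-edges\<close>

text \<open>An unordered pair has at most two orderings. This links ordered sibling pairs to the
  unordered pairs in \<open>overlapping_pairs\<close>.\<close>

lemma card_pairs_of_doubletons_le:
  assumes "finite X"
  shows "card {(a, b). {a, b} \<in> X} \<le> 2 * card X"
proof -
  have *: "finite {(a, b). {a, b} = e} \<and> card {(a, b). {a, b} = e} \<le> 2" for e :: "'a set"
  proof (cases "\<exists>x y. e = {x, y}")
    case True
    then obtain x y where "e = {x, y}" by blast
    then have sub: "{(a, b). {a, b} = e} \<subseteq> {(x, y), (y, x)}"
      by (auto simp: doubleton_eq_iff)
    have "card {(a, b). {a, b} = e} \<le> card {(x, y), (y, x)}"
      by (rule card_mono[OF _ sub]) simp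
    also have "\<dots> \<le> 2" using card_length[of "[(x, y), (y, x)]"] by simp
    finally show ?thesis using finite_subset[OF sub] by simp
  next
    case False
    then have "{(a, b). {a, b} = e} = {}" by auto
    then show ?thesis by simp
  qed
  have "{(a, b). {a, b} \<in> X} = (\<Union>e\<in>X. {(a, b). {a, b} = e})" by auto
  then have "card {(a, b). {a, b} \<in> X} \<le> (\<Sum>e\<in>X. card {(a, b). {a, b} = e})"
    using card_UN_le[OF assms] by metis
  also have "\<dots> \<le> card X * 2"
    using sum_bounded_above[of X "\<lambda>e. card {(a, b). {a, b} = e}" 2] * by simp
  finally show ?thesis by simp
qed

text \<open>Each unordered pair is counted in both orders. The cap \<open>D\<close> is a fixed
  truncation for the vertex and group perspectives; for the global one it grows with
  \<open>n\<close> and bounds every degree, so that nothing is cut off.\<close>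

definition siblings :: "rigc_params \<Rightarrow> nat \<Rightarrow> ((nat \<times> nat) \<times> (nat \<times> nat)) set" where
  "siblings R D = {(p, q). p \<in> l_half_edges R \<and> q \<in> l_half_edges R \<and> p \<noteq> q \<and> fst p = fst q \<and>
     ldeg R (fst p) \<le> D}"

text \<open>Half-edges are counted instead of individuals, so that an individual weighs as much as
  the number of communities it can spoil; uniform integrability controls exactly this
  weight.\<close>

definition high_l :: "rigc_params \<Rightarrow> nat \<Rightarrow> (nat \<times> nat) set" where
  "high_l R D = {p \<in> l_half_edges R. D < ldeg R (fst p)}"

definition high_r :: "rigc_params \<Rightarrow> nat \<Rightarrow> (nat \<times> nat) set" where
  "high_r R K = {r \<in> r_half_edges R. K < rdeg R (fst r)}"

definition joined :: "matching \<Rightarrow> (nat \<times> nat) \<times> (nat \<times> nat) \<Rightarrow> nat \<times> nat" where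
  "joined \<omega> c = (fst (\<omega> (fst c)), fst (\<omega> (snd c)))"

definition exceptional :: "rigc_params \<Rightarrow> nat \<Rightarrow> matching \<Rightarrow> (nat \<times> nat) \<times> (nat \<times> nat) \<Rightarrow> bool" where
  "exceptional R K \<omega> c \<longleftrightarrow> (case joined \<omega> c of (a, b) \<Rightarrow> K < rdeg R a \<or> K < rdeg R b \<or> a = b)"

text \<open>Equal values of \<open>joined\<close> make the last condition symmetric in the two
  sibling pairs. It bounds the sizes of both communities by \<open>K\<close> and keeps the
  communities distinct.\<close>

definition colliding :: "rigc_params \<Rightarrow> nat \<Rightarrow> matching \<Rightarrow>
    ((nat \<times> nat) \<times> (nat \<times> nat)) \<times> ((nat \<times> nat) \<times> (nat \<times> nat)) \<Rightarrow> bool" where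
  "colliding R K \<omega> x \<longleftrightarrow>
     fst x \<noteq> snd x \<and> joined \<omega> (fst x) = joined \<omega> (snd x) \<and> \<not> exceptional R K \<omega> (fst x)"

abbreviation collisions where
  "collisions R D K \<omega> \<equiv> {x \<in> siblings R D \<times> siblings R D. colliding R K \<omega> x}"

section \<open>Counting half-edges and sibling pairs\<close>

lemma finite_half_edges [simp]: "finite (l_half_edges R)" "finite (r_half_edges R)"
  by (auto simp: l_half_edges_def r_half_edges_def individuals_def communities_def)

lemma finite_high [simp]: "finite (high_l R D)" "finite (high_r R K)"
  by (auto simp: high_l_def high_r_def)

lemma finite_individuals_communities [simp]: "finite (individuals R)" "finite (communities R)"
  by (auto simp: individuals_def communities_def)

lemma card_half_edges:
  "card (l_half_edges R) = (\<Sum>v\<in>individuals R. ldeg R v)"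
  "card (r_half_edges R) = (\<Sum>a\<in>communities R. rdeg R a)"
  by (auto simp: l_half_edges_def r_half_edges_def)

lemma card_high_l: "card (high_l R D) = (\<Sum>v | v \<in> individuals R \<and> D < ldeg R v. ldeg R v)"
proof -
  have "high_l R D = (SIGMA v:{v \<in> individuals R. D < ldeg R v}. {1..ldeg R v})"
    by (auto simp: high_l_def l_half_edges_def)
  then show ?thesis by simp
qed

lemma card_high_r: "card (high_r R D) = (\<Sum>v | v \<in> communities R \<and> D < rdeg R v. rdeg R v)"
proof -
  have "high_r R D = (SIGMA v:{v \<in> communities R. D < rdeg R v}. {1..rdeg R v})"
    by (auto simp: high_r_def r_half_edges_def)
  then show ?thesis by simp
qed

lemma card_l_half_edges_at: "card {q \<in> l_half_edges R. fst q = v} \<le> ldeg R v"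
proof -
  have "{q \<in> l_half_edges R. fst q = v} \<subseteq> {v} \<times> {1..ldeg R v}"
    by (auto simp: l_half_edges_def)
  from card_mono[OF _ this] show ?thesis by simp
qed

lemma card_r_half_edges_at: "card {s \<in> r_half_edges R. fst s = a} \<le> rdeg R a"
proof -
  have "{s \<in> r_half_edges R. fst s = a} \<subseteq> {a} \<times> {1..rdeg R a}"
    by (auto simp: r_half_edges_def)
  from card_mono[OF _ this] show ?thesis by simp
qed

lemma card_Sigma_le:
  assumes "finite A" "\<And>x. x \<in> A \<Longrightarrow> finite (B x)" "\<And>x. x \<in> A \<Longrightarrow> card (B x) \<le> k"
  shows "card (SIGMA x:A. B x) \<le> card A * k"
  using sum_bounded_above[of A "\<lambda>x. card (B x)" k] assms by (simp add: card_SigmaI)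

lemma finite_siblings [simp]: "finite (siblings R D)"
  by (rule finite_subset[of _ "l_half_edges R \<times> l_half_edges R"]) (auto simp: siblings_def)

lemma card_siblings_le: "card (siblings R D) \<le> card (l_half_edges R) * D"
proof -
  have "card (siblings R D) \<le>
      card (SIGMA p:{p \<in> l_half_edges R. ldeg R (fst p) \<le> D}. {q \<in> l_half_edges R. fst q = fst p})"
    by (rule card_mono) (auto simp: siblings_def)
  also have "\<dots> \<le> card {p \<in> l_half_edges R. ldeg R (fst p) \<le> D} * D"
    by (rule card_Sigma_le) (auto intro: order.trans[OF card_l_half_edges_at])
  also have "\<dots> \<le> card (l_half_edges R) * D"
    by (intro mult_right_mono card_mono) auto
  finally show ?thesis .
qed

text \<open>A sibling pair is determined by its individual and two labels. This bound is free of
  \<open>D\<close> and so stays of order \<open>h\<close> when \<open>D\<close> grows with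
  \<open>n\<close>.\<close>

lemma card_siblings_le_sum_squares:
  "card (siblings R D) \<le> (\<Sum>v\<in>individuals R. (ldeg R v)\<^sup>2)"
proof -
  have "card (siblings R D) \<le> card (SIGMA v:individuals R. {1..ldeg R v} \<times> {1..ldeg R v})"
  proof (rule card_inj_on_le[where f = "\<lambda>c. (fst (fst c), snd (fst c), snd (snd c))"])
    show "inj_on (\<lambda>c. (fst (fst c), snd (fst c), snd (snd c))) (siblings R D)"
      by (auto simp: inj_on_def siblings_def)
  qed (auto simp: siblings_def l_half_edges_def)
  then show ?thesis by (simp add: power2_eq_square)
qed

text \<open>Fixing the first half-edge fixes the individual, which leaves at most \<open>D\<close>
  choices for the second.\<close>

lemma card_siblings_fst_eq_le:
  assumes "c \<in> siblings R D"
  shows "card {c' \<in> siblings R D. fst c' = fst c} \<le> D"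
proof -
  have "card {c' \<in> siblings R D. fst c' = fst c} \<le> card {q \<in> l_half_edges R. fst q = fst (fst c)}"
    by (rule card_inj_on_le[where f = snd]) (auto simp: inj_on_def siblings_def)
  also have "\<dots> \<le> D"
    using assms by (intro order.trans[OF card_l_half_edges_at]) (auto simp: siblings_def)
  finally show ?thesis .
qed

lemma card_siblings_snd_eq_le:
  assumes "c \<in> siblings R D"
  shows "card {c' \<in> siblings R D. snd c' = snd c} \<le> D"
proof -
  have "card {c' \<in> siblings R D. snd c' = snd c} \<le> card {q \<in> l_half_edges R. fst q = fst (fst c)}"
    by (rule card_inj_on_le[where f = fst]) (use assms in \<open>auto simp: inj_on_def siblings_def\<close>)
  also have "\<dots> \<le> D"
    using assms by (intro order.trans[OF card_l_half_edges_at]) (auto simp: siblings_def)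
  finally show ?thesis .
qed

section \<open>Overlaps and membership read off from the matching\<close>

lemma overlap_commute: "overlap R \<omega> a b = overlap R \<omega> b a"
  by (simp add: overlap_def conj_commute)

lemma mem_overlapping_pairs_iff:
  "{a, b} \<in> overlapping_pairs R \<omega> k \<longleftrightarrow>
     a \<in> communities R \<and> b \<in> communities R \<and> a \<noteq> b \<and> k \<le> overlap R \<omega> a b"
  by (auto simp: overlapping_pairs_def doubleton_eq_iff overlap_commute)

lemma overlapping_pairsE:
  assumes "e \<in> overlapping_pairs R \<omega> k"
  obtains a b where "e = {a, b}" "a \<in> communities R" "b \<in> communities R" "a \<noteq> b"
    "k \<le> overlap R \<omega> a b"
  using assms by (auto simp: overlapping_pairs_def)

lemma finite_overlapping_pairs [simp]: "finite (overlapping_pairs R \<omega> k)"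
  by (rule finite_subset[of _ "Pow (communities R)"]) (auto simp: overlapping_pairs_def)

lemma overlapping_pairs_antimono: "k \<le> l \<Longrightarrow> overlapping_pairs R \<omega> l \<subseteq> overlapping_pairs R \<omega> k"
  by (fastforce simp: overlapping_pairs_def)

text \<open>The individual \<open>v\<close> to be avoided is arbitrary, so the same rule supplies a
  first common individual and then a second one different from it.\<close>

lemma overlap_ge_2D:
  assumes "2 \<le> overlap R \<omega> a b"
  obtains w where "w \<noteq> v" "part_of R \<omega> w a" "part_of R \<omega> w b"
proof -
  let ?X = "{v \<in> individuals R. part_of R \<omega> v a \<and> part_of R \<omega> v b}"
  have "\<not> ?X \<subseteq> {v}"
    using card_mono[of "{v}" ?X] assms by (auto simp: overlap_def)
  then show ?thesis using that by auto
qed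

lemma overlap_pos_iff:
  "1 \<le> overlap R \<omega> a b \<longleftrightarrow> (\<exists>v. part_of R \<omega> v a \<and> part_of R \<omega> v b)"
  by (auto simp: overlap_def Suc_le_eq card_gt_0_iff part_of_def takes_role_def)

lemma matchings_eq_bijections: "matchings R = bijections (l_half_edges R) (r_half_edges R)"
  by (simp add: matchings_def bijections_def)

lemma matching_mem: "\<omega> \<in> matchings R \<Longrightarrow> p \<in> l_half_edges R \<Longrightarrow> \<omega> p \<in> r_half_edges R"
  by (auto simp: matchings_def)

lemma matching_inj: "\<omega> \<in> matchings R \<Longrightarrow> inj_on \<omega> (l_half_edges R)"
  by (auto simp: matchings_def bij_betw_def)

text \<open>Restates membership in the domain of the matching, where the counting takes place. From
  right to left, the role number is admissible because the matching takes values in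
  \<open>r_half_edges R\<close>.\<close>

lemma part_of_iff:
  assumes "\<omega> \<in> matchings R"
  shows "part_of R \<omega> v a \<longleftrightarrow> (\<exists>p\<in>l_half_edges R. fst p = v \<and> fst (\<omega> p) = a)"
proof
  assume "part_of R \<omega> v a"
  then show "\<exists>p\<in>l_half_edges R. fst p = v \<and> fst (\<omega> p) = a"
    by (auto simp: part_of_def takes_role_def l_half_edges_def intro!: bexI)
next
  assume "\<exists>p\<in>l_half_edges R. fst p = v \<and> fst (\<omega> p) = a"
  then obtain p where p: "p \<in> l_half_edges R" "fst p = v" "fst (\<omega> p) = a" by blast
  with matching_mem[OF assms p(1)] have "snd (\<omega> p) \<in> {1..rdeg R a}"
    by (auto simp: r_half_edges_def)
  moreover have "takes_role R \<omega> v (a, snd (\<omega> p))"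
    using p by (force simp: takes_role_def l_half_edges_def)
  ultimately show "part_of R \<omega> v a" by (auto simp: part_of_def)
qed

lemma part_ofE:
  assumes "\<omega> \<in> matchings R" "part_of R \<omega> v a"
  obtains p where "p \<in> l_half_edges R" "fst p = v" "fst (\<omega> p) = a"
  using assms by (auto simp: part_of_iff)

lemma card_matched_high_r_le:
  assumes "\<omega> \<in> matchings R"
  shows "card {p \<in> l_half_edges R. K < rdeg R (fst (\<omega> p))} \<le> card (high_r R K)"
  by (rule card_inj_on_le[where f = \<omega>])
     (use matching_inj[OF assms] matching_mem[OF assms] in
       \<open>auto simp: high_r_def intro: inj_on_subset\<close>)

lemma card_matched_at_le:
  assumes "\<omega> \<in> matchings R"
  shows "card {p \<in> l_half_edges R. fst (\<omega> p) = a} \<le> rdeg R a"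
proof -
  have "card {p \<in> l_half_edges R. fst (\<omega> p) = a} \<le> card {s \<in> r_half_edges R. fst s = a}"
    by (rule card_inj_on_le[where f = \<omega>])
       (use matching_inj[OF assms] matching_mem[OF assms] in \<open>auto intro: inj_on_subset\<close>)
  then show ?thesis using card_r_half_edges_at[of R a] by simp
qed

section \<open>Deterministic counts of bad individuals, bad communities and overlapping
  pairs\<close>

lemma finite_collisions [simp]: "finite (collisions R D K \<omega>)"
  by (rule finite_subset[of _ "siblings R D \<times> siblings R D"]) auto

text \<open>Let \<open>v\<close> lie in \<open>a\<close> and \<open>b\<close>, whose overlap
  contains a further individual \<open>w\<close>. Either one of the communities is large, or
  \<open>v\<close> has high degree, or \<open>w\<close> has high degree and leads to
  \<open>v\<close> through one of at most \<open>K\<close> roles of \<open>a\<close>, or the sibling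
  pairs of \<open>v\<close> and \<open>w\<close> collide.\<close>

lemma card_vertex_bad_le:
  assumes \<omega>: "\<omega> \<in> matchings R"
  shows "card {v \<in> individuals R. \<exists>a b. {a, b} \<in> overlapping_pairs R \<omega> 2 \<and>
            part_of R \<omega> v a \<and> part_of R \<omega> v b}
    \<le> card (high_r R K) + card (high_l R D) * (1 + K) + card (collisions R D K \<omega>)"
    (is "card ?bad \<le> _")
proof -
  let ?L = "l_half_edges R"
  let ?B1 = "{p \<in> ?L. K < rdeg R (fst (\<omega> p))}"
  \<comment> \<open>Charges \<open>v\<close> to a \<open>w\<close> of high degree: \<open>p\<close>
    is a half-edge of \<open>w\<close>, and \<open>q\<close> is one of \<open>v\<close> in the same
    community. The size condition keeps every fibre at most \<open>K\<close>.\<close>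
  let ?B3 = "SIGMA p:high_l R D. {q \<in> ?L. fst (\<omega> q) = fst (\<omega> p) \<and> rdeg R (fst (\<omega> p)) \<le> K}"
  have "?bad \<subseteq> fst ` ?B1 \<union> fst ` high_l R D \<union> (fst \<circ> snd) ` ?B3
      \<union> (fst \<circ> fst \<circ> fst) ` collisions R D K \<omega>"
  proof
    fix v assume "v \<in> ?bad"
    then obtain a b where ab: "a \<noteq> b" "2 \<le> overlap R \<omega> a b" "part_of R \<omega> v a" "part_of R \<omega> v b"
      by (auto simp: mem_overlapping_pairs_iff)
    obtain w where w: "w \<noteq> v" "part_of R \<omega> w a" "part_of R \<omega> w b"
      using overlap_ge_2D[OF ab(2)] .
    obtain p where p: "p \<in> ?L" "fst p = v" "fst (\<omega> p) = a" using part_ofE[OF \<omega> ab(3)] .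
    obtain q where q: "q \<in> ?L" "fst q = v" "fst (\<omega> q) = b" using part_ofE[OF \<omega> ab(4)] .
    obtain p' where p': "p' \<in> ?L" "fst p' = w" "fst (\<omega> p') = a" using part_ofE[OF \<omega> w(2)] .
    obtain q' where q': "q' \<in> ?L" "fst q' = w" "fst (\<omega> q') = b" using part_ofE[OF \<omega> w(3)] .
    consider "K < rdeg R a" | "K < rdeg R b" | "D < ldeg R v" | "D < ldeg R w" "rdeg R a \<le> K"
      | "rdeg R a \<le> K" "rdeg R b \<le> K" "ldeg R v \<le> D" "ldeg R w \<le> D"
      by linarith
    then show "v \<in> fst ` ?B1 \<union> fst ` high_l R D \<union> (fst \<circ> snd) ` ?B3
      \<union> (fst \<circ> fst \<circ> fst) ` collisions R D K \<omega>"
    proof cases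
      case 1
      with p have "p \<in> ?B1" by simp
      with p(2) show ?thesis by blast
    next
      case 2
      with q have "q \<in> ?B1" by simp
      with q(2) show ?thesis by blast
    next
      case 3
      with p have "p \<in> high_l R D" by (simp add: high_l_def)
      with p(2) show ?thesis by blast
    next
      case 4
      with p p' have "(p', p) \<in> ?B3" by (simp add: high_l_def)
      from imageI[OF this, of "fst \<circ> snd"] p(2) show ?thesis by simp
    next
      case 5
      with p q p' q' ab w have "((p, q), (p', q')) \<in> collisions R D K \<omega>"
        by (auto simp: colliding_def joined_def exceptional_def siblings_def)
      from imageI[OF this, of "fst \<circ> fst \<circ> fst"] p(2) show ?thesis by simp
    qed
  qed
  then have "card ?bad \<le> card (fst ` ?B1 \<union> fst ` high_l R D \<union> (fst \<circ> snd) ` ?B3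
      \<union> (fst \<circ> fst \<circ> fst) ` collisions R D K \<omega>)"
    by (intro card_mono) auto
  also have "\<dots> \<le> card ?B1 + card (high_l R D) + card ?B3 + card (collisions R D K \<omega>)"
    by (intro order.trans[OF card_Un_le] add_mono card_image_le) auto
  also have "card ?B1 \<le> card (high_r R K)" by (rule card_matched_high_r_le[OF \<omega>])
  also have "card ?B3 \<le> card (high_l R D) * K"
  proof (rule card_Sigma_le)
    fix p
    show "card {q \<in> ?L. fst (\<omega> q) = fst (\<omega> p) \<and> rdeg R (fst (\<omega> p)) \<le> K} \<le> K"
      using card_matched_at_le[OF \<omega>, of "fst (\<omega> p)"] by (cases "rdeg R (fst (\<omega> p)) \<le> K") auto
  qed auto
  finally show ?thesis by simp
qed

text \<open>Dual to \<open>card_vertex_bad_le\<close>: a high degree of \<open>v\<close> or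
  \<open>w\<close> is charged directly to a half-edge in \<open>a\<close>, while a large neighbour
  \<open>b\<close> leads to \<open>a\<close> through the at most \<open>D\<close> half-edges of a
  shared individual.\<close>

lemma card_group_bad_le:
  assumes \<omega>: "\<omega> \<in> matchings R"
  shows "card {a \<in> communities R. \<exists>b\<in>nbr_communities R \<omega> a. 2 \<le> overlap R \<omega> a b}
    \<le> card (high_r R K) * (1 + D) + card (high_l R D) + card (collisions R D K \<omega>)"
    (is "card ?bad \<le> _")
proof -
  let ?L = "l_half_edges R"
  let ?B1 = "{p \<in> ?L. K < rdeg R (fst (\<omega> p))}"
  let ?B3 = "SIGMA q:?B1. {p \<in> ?L. fst p = fst q \<and> ldeg R (fst q) \<le> D}"
  have "?bad \<subseteq> (fst \<circ> \<omega>) ` ?B1 \<union> (fst \<circ> \<omega>) ` high_l R D \<union> (fst \<circ> \<omega> \<circ> snd) ` ?B3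
      \<union> (fst \<circ> joined \<omega> \<circ> fst) ` collisions R D K \<omega>"
  proof
    fix a assume "a \<in> ?bad"
    then obtain b where ab: "b \<noteq> a" "2 \<le> overlap R \<omega> a b"
      by (auto simp: nbr_communities_def)
    obtain v where v: "part_of R \<omega> v a" "part_of R \<omega> v b"
      using overlap_ge_2D[OF ab(2)] by metis
    obtain w where w: "w \<noteq> v" "part_of R \<omega> w a" "part_of R \<omega> w b"
      using overlap_ge_2D[OF ab(2)] .
    obtain p where p: "p \<in> ?L" "fst p = v" "fst (\<omega> p) = a" using part_ofE[OF \<omega> v(1)] .
    obtain q where q: "q \<in> ?L" "fst q = v" "fst (\<omega> q) = b" using part_ofE[OF \<omega> v(2)] .
    obtain p' where p': "p' \<in> ?L" "fst p' = w" "fst (\<omega> p') = a" using part_ofE[OF \<omega> w(2)] .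
    obtain q' where q': "q' \<in> ?L" "fst q' = w" "fst (\<omega> q') = b" using part_ofE[OF \<omega> w(3)] .
    consider "K < rdeg R a" | "D < ldeg R v" | "D < ldeg R w" | "K < rdeg R b" "ldeg R v \<le> D"
      | "rdeg R a \<le> K" "rdeg R b \<le> K" "ldeg R v \<le> D" "ldeg R w \<le> D"
      by linarith
    then show "a \<in> (fst \<circ> \<omega>) ` ?B1 \<union> (fst \<circ> \<omega>) ` high_l R D \<union> (fst \<circ> \<omega> \<circ> snd) ` ?B3
      \<union> (fst \<circ> joined \<omega> \<circ> fst) ` collisions R D K \<omega>"
    proof cases
      case 1
      with p have "p \<in> ?B1" by simp
      from imageI[OF this, of "fst \<circ> \<omega>"] p(3) show ?thesis by simp
    next
      case 2
      with p have "p \<in> high_l R D" by (simp add: high_l_def)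
      from imageI[OF this, of "fst \<circ> \<omega>"] p(3) show ?thesis by simp
    next
      case 3
      with p' have "p' \<in> high_l R D" by (simp add: high_l_def)
      from imageI[OF this, of "fst \<circ> \<omega>"] p'(3) show ?thesis by simp
    next
      case 4
      with p q have "(q, p) \<in> ?B3" by simp
      from imageI[OF this, of "fst \<circ> \<omega> \<circ> snd"] p(3) show ?thesis by simp
    next
      case 5
      with p q p' q' ab w have "((p, q), (p', q')) \<in> collisions R D K \<omega>"
        by (auto simp: colliding_def joined_def exceptional_def siblings_def)
      from imageI[OF this, of "fst \<circ> joined \<omega> \<circ> fst"] p(3) show ?thesis by (simp add: joined_def)
    qed
  qed
  then have "card ?bad \<le> card ((fst \<circ> \<omega>) ` ?B1 \<union> (fst \<circ> \<omega>) ` high_l R D \<union> (fst \<circ> \<omega> \<circ> snd) ` ?B3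
      \<union> (fst \<circ> joined \<omega> \<circ> fst) ` collisions R D K \<omega>)"
    by (intro card_mono) auto
  also have "\<dots> \<le> card ?B1 + card (high_l R D) + card ?B3 + card (collisions R D K \<omega>)"
    by (intro order.trans[OF card_Un_le] add_mono card_image_le) auto
  also have "card ?B3 \<le> card ?B1 * D"
  proof (rule card_Sigma_le)
    fix q
    show "card {p \<in> ?L. fst p = fst q \<and> ldeg R (fst q) \<le> D} \<le> D"
      using card_l_half_edges_at[of R "fst q"] by (cases "ldeg R (fst q) \<le> D") auto
  qed auto
  finally have "card ?bad \<le> card ?B1 * (1 + D) + card (high_l R D) + card (collisions R D K \<omega>)"
    by simp
  also have "card ?B1 * (1 + D) \<le> card (high_r R K) * (1 + D)"
    by (intro mult_right_mono card_matched_high_r_le[OF \<omega>]) simp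
  finally show ?thesis by simp
qed

text \<open>Such a pair is hit by a sibling pair of one common individual \<open>v\<close>, which is
  exceptional or else collides with a sibling pair of a second individual \<open>w\<close>. Since
  all degrees are at most \<open>D\<close>, the truncation in \<open>siblings\<close> loses
  neither.\<close>

lemma card_overlapping_pairs_2_le:
  assumes \<omega>: "\<omega> \<in> matchings R" and D: "\<And>v. v \<in> individuals R \<Longrightarrow> ldeg R v \<le> D"
  shows "card (overlapping_pairs R \<omega> 2) \<le>
    card {c \<in> siblings R D. exceptional R K \<omega> c} + card (collisions R D K \<omega>)"
proof -
  let ?L = "l_half_edges R"
  let ?f = "\<lambda>c. {fst (joined \<omega> c), snd (joined \<omega> c)}"
  have "overlapping_pairs R \<omega> 2 \<subseteq>
      ?f ` {c \<in> siblings R D. exceptional R K \<omega> c} \<union> (?f \<circ> fst) ` collisions R D K \<omega>"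
  proof
    fix e assume "e \<in> overlapping_pairs R \<omega> 2"
    then obtain a b where ab: "e = {a, b}" "a \<noteq> b" "2 \<le> overlap R \<omega> a b"
      by (rule overlapping_pairsE)
    obtain v where v: "part_of R \<omega> v a" "part_of R \<omega> v b"
      using overlap_ge_2D[OF ab(3)] by metis
    obtain w where w: "w \<noteq> v" "part_of R \<omega> w a" "part_of R \<omega> w b"
      using overlap_ge_2D[OF ab(3)] .
    obtain p where p: "p \<in> ?L" "fst p = v" "fst (\<omega> p) = a" using part_ofE[OF \<omega> v(1)] .
    obtain q where q: "q \<in> ?L" "fst q = v" "fst (\<omega> q) = b" using part_ofE[OF \<omega> v(2)] .
    obtain p' where p': "p' \<in> ?L" "fst p' = w" "fst (\<omega> p') = a" using part_ofE[OF \<omega> w(2)] .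
    obtain q' where q': "q' \<in> ?L" "fst q' = w" "fst (\<omega> q') = b" using part_ofE[OF \<omega> w(3)] .
    have deg: "ldeg R v \<le> D" "ldeg R w \<le> D"
      using D p p' by (auto simp: l_half_edges_def)
    have S: "(p, q) \<in> siblings R D" "(p', q') \<in> siblings R D"
      using p q p' q' ab deg by (auto simp: siblings_def)
    have f: "?f (p, q) = e" using p q ab by (simp add: joined_def)
    show "e \<in> ?f ` {c \<in> siblings R D. exceptional R K \<omega> c} \<union> (?f \<circ> fst) ` collisions R D K \<omega>"
    proof (cases "exceptional R K \<omega> (p, q)")
      case True
      with S f show ?thesis by blast
    next
      case False
      with S p q p' q' w have "((p, q), (p', q')) \<in> collisions R D K \<omega>"
        by (auto simp: colliding_def joined_def)
      from imageI[OF this, of "?f \<circ> fst"] f show ?thesis by simp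
    qed
  qed
  then have "card (overlapping_pairs R \<omega> 2) \<le>
      card (?f ` {c \<in> siblings R D. exceptional R K \<omega> c} \<union> (?f \<circ> fst) ` collisions R D K \<omega>)"
    by (intro card_mono) auto
  also have "\<dots> \<le> card {c \<in> siblings R D. exceptional R K \<omega> c} + card (collisions R D K \<omega>)"
    by (intro order.trans[OF card_Un_le] add_mono card_image_le) auto
  finally show ?thesis .
qed

text \<open>Sibling pairs that are not exceptional land on overlapping communities, in one of two
  orders, and multiple hits are paid for by collisions. This bounds the denominator of the global
  ratio from below.\<close>

lemma card_siblings_le_overlapping_pairs_1:
  assumes \<omega>: "\<omega> \<in> matchings R"
  shows "card (siblings R D) \<le> 2 * card (overlapping_pairs R \<omega> 1) +
    card {c \<in> siblings R D. exceptional R K \<omega> c} + card (collisions R D K \<omega>)"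
proof -
  let ?S = "siblings R D"
  let ?E = "{c \<in> ?S. exceptional R K \<omega> c}"
  have "joined \<omega> ` (?S - ?E) \<subseteq> {(a, b). {a, b} \<in> overlapping_pairs R \<omega> 1}"
  proof (rule image_subsetI)
    fix c assume "c \<in> ?S - ?E"
    then obtain p q where c: "c = (p, q)" "p \<in> l_half_edges R" "q \<in> l_half_edges R"
        "fst p = fst q" "fst (\<omega> p) \<noteq> fst (\<omega> q)"
      by (auto simp: siblings_def exceptional_def joined_def)
    have "fst (\<omega> p) \<in> communities R" "fst (\<omega> q) \<in> communities R"
      using matching_mem[OF \<omega> c(2)] matching_mem[OF \<omega> c(3)] by (auto simp: r_half_edges_def)
    moreover have "1 \<le> overlap R \<omega> (fst (\<omega> p)) (fst (\<omega> q))"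
      unfolding overlap_pos_iff part_of_iff[OF \<omega>] using c by metis
    ultimately show "joined \<omega> c \<in> {(a, b). {a, b} \<in> overlapping_pairs R \<omega> 1}"
      using c by (auto simp: joined_def mem_overlapping_pairs_iff)
  qed
  moreover have fin: "finite {(a, b). {a, b} \<in> overlapping_pairs R \<omega> 1}"
    by (rule finite_subset[of _ "communities R \<times> communities R"])
       (auto simp: mem_overlapping_pairs_iff)
  ultimately have "card (joined \<omega> ` (?S - ?E)) \<le> card {(a, b). {a, b} \<in> overlapping_pairs R \<omega> 1}"
    by (intro card_mono)
  also have "\<dots> \<le> 2 * card (overlapping_pairs R \<omega> 1)"
    by (rule card_pairs_of_doubletons_le) simp
  finally have 1: "card (joined \<omega> ` (?S - ?E)) \<le> 2 * card (overlapping_pairs R \<omega> 1)" .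
  have 2: "card {(c, c'). c \<in> ?S - ?E \<and> c' \<in> ?S - ?E \<and> c \<noteq> c' \<and> joined \<omega> c = joined \<omega> c'}
      \<le> card (collisions R D K \<omega>)"
    by (rule card_mono) (auto simp: colliding_def)
  have "card ?S = card ?E + card (?S - ?E)"
    using card_Diff_subset[of ?E ?S] card_mono[of ?S ?E] by auto
  with 1 2 card_le_image_add_collisions[of "?S - ?E" "joined \<omega>"] show ?thesis by simp
qed

section \<open>Probability estimates for one matching\<close>

text \<open>Counterpart of \<open>siblings\<close> among the roles: two half-edges sent to one
  community of size at most \<open>K\<close> have their images here. Pairs with \<open>r = s\<close>
  are included, and the bound below covers them.\<close>

definition twins :: "rigc_params \<Rightarrow> nat \<Rightarrow> ((nat \<times> nat) \<times> (nat \<times> nat)) set" where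
  "twins R K = {(r, s). r \<in> r_half_edges R \<and> s \<in> r_half_edges R \<and> fst r = fst s \<and>
     rdeg R (fst r) \<le> K}"

lemma finite_twins [simp]: "finite (twins R K)"
  by (rule finite_subset[of _ "r_half_edges R \<times> r_half_edges R"]) (auto simp: twins_def)

lemma card_twins_le: "card (twins R K) \<le> card (r_half_edges R) * K"
proof -
  have "card (twins R K) \<le>
      card (SIGMA r:{r \<in> r_half_edges R. rdeg R (fst r) \<le> K}. {s \<in> r_half_edges R. fst s = fst r})"
    by (rule card_mono) (auto simp: twins_def)
  also have "\<dots> \<le> card {r \<in> r_half_edges R. rdeg R (fst r) \<le> K} * K"
    by (rule card_Sigma_le) (auto intro: order.trans[OF card_r_half_edges_at])
  also have "\<dots> \<le> card (r_half_edges R) * K"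
    by (intro mult_right_mono card_mono) auto
  finally show ?thesis .
qed

lemma set_pmf_random_matching:
  assumes "card (l_half_edges R) = card (r_half_edges R)"
  shows "set_pmf (random_matching R) = matchings R"
  using assms by (simp add: random_matching_def matchings_eq_bijections bijections_nonempty
      finite_bijections)

lemma prob_random_matching_mono:
  assumes "card (l_half_edges R) = card (r_half_edges R)"
    and "\<And>\<omega>. \<omega> \<in> matchings R \<Longrightarrow> P \<omega> \<Longrightarrow> Q \<omega>"
  shows "measure_pmf.prob (random_matching R) {\<omega>. P \<omega>}
      \<le> measure_pmf.prob (random_matching R) {\<omega>. Q \<omega>}"
  by (rule measure_pmf.finite_measure_mono_AE)
     (use assms in \<open>auto simp: AE_measure_pmf_iff set_pmf_random_matching\<close>)

lemma prob_disj_le: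
  "measure_pmf.prob p {x. P x \<or> Q x} \<le> measure_pmf.prob p {x. P x} + measure_pmf.prob p {x. Q x}"
  using measure_Un_le[of "{x. P x}" "measure_pmf p" "{x. Q x}"] by (simp add: Un_def)

section \<open>First-moment bounds for exceptional and colliding sibling pairs\<close>

context
  fixes R :: rigc_params and h :: real
  assumes card_eq: "card (l_half_edges R) = card (r_half_edges R)"
    and card_ge: "6 \<le> card (l_half_edges R)"
  defines "h \<equiv> real (card (l_half_edges R))"
begin

abbreviation (input) "Pr Q \<equiv> measure_pmf.prob (random_matching R) {\<omega>. Q \<omega>}"

lemma h_pos: "0 < h"
  using card_ge by (simp add: h_def)

text \<open>Reduces an event about a few half-edges to counting: it is enough to find a set
  \<open>E\<close> of value lists that contains their images.\<close>

lemma prob_matching_le: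
  assumes "distinct ps" "set ps \<subseteq> l_half_edges R" "length ps \<le> 4" "finite E" "real (card E) \<le> c"
    and "\<And>\<omega>. \<omega> \<in> matchings R \<Longrightarrow> Q \<omega> \<Longrightarrow> map \<omega> ps \<in> E"
  shows "Pr Q \<le> c * (2 / h) ^ length ps"
proof -
  have "Pr Q \<le> Pr (\<lambda>\<omega>. map \<omega> ps \<in> E)"
    by (rule prob_random_matching_mono[OF card_eq assms(6)])
  also have "\<dots> \<le> c * (2 / h) ^ length ps"
    unfolding random_matching_def matchings_eq_bijections h_def
    by (rule prob_map_in_le[OF _ _ card_eq card_ge assms(1-5)]) auto
  finally show ?thesis .
qed

lemma prob_high_r_le:
  assumes "p \<in> l_half_edges R"
  shows "Pr (\<lambda>\<omega>. K < rdeg R (fst (\<omega> p))) \<le> 2 * real (card (high_r R K)) / h"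
proof -
  have "Pr (\<lambda>\<omega>. K < rdeg R (fst (\<omega> p))) \<le> real (card (high_r R K)) * (2 / h) ^ length [p]"
    by (rule prob_matching_le[where E = "(\<lambda>r. [r]) ` high_r R K"])
       (use assms matching_mem in \<open>auto simp: high_r_def intro: card_image_le\<close>)
  then show ?thesis by (simp add: mult_ac)
qed

text \<open>At most \<open>h K\<close> pairs of roles lie in a common community of size at most
  \<open>K\<close>, and each is the image of \<open>(p, q)\<close> with probability at most
  \<open>(2 / h)^2\<close>.\<close>

lemma prob_twins_le:
  assumes "p \<in> l_half_edges R" "q \<in> l_half_edges R" "p \<noteq> q"
  shows "Pr (\<lambda>\<omega>. fst (\<omega> p) = fst (\<omega> q) \<and> rdeg R (fst (\<omega> p)) \<le> K) \<le> 4 * real K / h"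
proof -
  have c: "card ((\<lambda>(r, s). [r, s]) ` twins R K) \<le> card (r_half_edges R) * K"
    by (rule order.trans[OF card_image_le card_twins_le]) simp
  have "Pr (\<lambda>\<omega>. fst (\<omega> p) = fst (\<omega> q) \<and> rdeg R (fst (\<omega> p)) \<le> K)
      \<le> (h * real K) * (2 / h) ^ length [p, q]"
  proof (rule prob_matching_le[where E = "(\<lambda>(r, s). [r, s]) ` twins R K"])
    show "real (card ((\<lambda>(r, s). [r, s]) ` twins R K)) \<le> h * real K"
      using of_nat_mono[OF c, where 'a = real] unfolding h_def card_eq of_nat_mult .
  next
    fix \<omega> assume "\<omega> \<in> matchings R" "fst (\<omega> p) = fst (\<omega> q) \<and> rdeg R (fst (\<omega> p)) \<le> K"
    then have "(\<omega> p, \<omega> q) \<in> twins R K"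
      using assms matching_mem by (auto simp: twins_def)
    then show "map \<omega> [p, q] \<in> (\<lambda>(r, s). [r, s]) ` twins R K"
      by (auto intro: rev_image_eqI)
  qed (use assms in auto)
  also have "\<dots> = 4 * real K / h"
    using h_pos by (simp add: power2_eq_square)
  finally show ?thesis .
qed

text \<open>Two such coincidences at four distinct half-edges: at most \<open>(h K)^2\<close> value
  lists, each of probability at most \<open>(2 / h)^4\<close>.\<close>

lemma prob_two_twins_le:
  assumes "distinct [p, p', q, q']" "set [p, p', q, q'] \<subseteq> l_half_edges R"
  shows "Pr (\<lambda>\<omega>. fst (\<omega> p) = fst (\<omega> p') \<and> rdeg R (fst (\<omega> p)) \<le> K \<and>
      fst (\<omega> q) = fst (\<omega> q') \<and> rdeg R (fst (\<omega> q)) \<le> K) \<le> 16 * (real K)\<^sup>2 / h\<^sup>2" (is "Pr ?Q \<le> _")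
proof -
  let ?E = "(\<lambda>((r, r'), (s, s')). [r, r', s, s']) ` (twins R K \<times> twins R K)"
  have "card ?E \<le> card (twins R K \<times> twins R K)"
    by (rule card_image_le) simp
  also have "\<dots> \<le> (card (r_half_edges R) * K) * (card (r_half_edges R) * K)"
    unfolding card_cartesian_product by (intro mult_mono card_twins_le) auto
  finally have c: "card ?E \<le> (card (r_half_edges R) * K) * (card (r_half_edges R) * K)" .
  have "Pr ?Q \<le> ((h * real K) * (h * real K)) * (2 / h) ^ length [p, p', q, q']"
  proof (rule prob_matching_le[where E = ?E])
    show "real (card ?E) \<le> (h * real K) * (h * real K)"
      using of_nat_mono[OF c, where 'a = real] unfolding h_def card_eq of_nat_mult .
  next
    fix \<omega> assume "\<omega> \<in> matchings R" "?Q \<omega>"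
    then have "((\<omega> p, \<omega> p'), (\<omega> q, \<omega> q')) \<in> twins R K \<times> twins R K"
      using assms matching_mem by (auto simp: twins_def)
    then show "map \<omega> [p, p', q, q'] \<in> ?E"
      by (rule rev_image_eqI) simp
  qed (use assms in auto)
  also have "\<dots> = 16 * (real K)\<^sup>2 / h\<^sup>2"
    using h_pos by (simp add: power2_eq_square power4_eq_xxxx)
  finally show ?thesis .
qed

lemma prob_exceptional_le:
  assumes "c \<in> siblings R D"
  shows "Pr (\<lambda>\<omega>. exceptional R K \<omega> c) \<le> 4 * real (card (high_r R K)) / h + 4 * real K / h"
proof -
  obtain p q where c: "c = (p, q)" "p \<in> l_half_edges R" "q \<in> l_half_edges R" "p \<noteq> q"
    using assms by (auto simp: siblings_def)
  let ?A = "\<lambda>\<omega>. K < rdeg R (fst (\<omega> p))" and ?B = "\<lambda>\<omega>. K < rdeg R (fst (\<omega> q))"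
    and ?C = "\<lambda>\<omega>. fst (\<omega> p) = fst (\<omega> q) \<and> rdeg R (fst (\<omega> p)) \<le> K"
  have "Pr (\<lambda>\<omega>. exceptional R K \<omega> c) \<le> Pr (\<lambda>\<omega>. ?A \<omega> \<or> ?B \<omega> \<or> ?C \<omega>)"
    by (rule prob_random_matching_mono[OF card_eq]) (auto simp: exceptional_def joined_def c)
  also have "\<dots> \<le> Pr ?A + (Pr ?B + Pr ?C)"
    by (intro order.trans[OF prob_disj_le] add_left_mono prob_disj_le)
  also have "\<dots> \<le> 2 * real (card (high_r R K)) / h + (2 * real (card (high_r R K)) / h + 4 * real K / h)"
    by (intro add_mono prob_high_r_le prob_twins_le c)
  finally show ?thesis by simp
qed

text \<open>The order of the bound depends on the half-edges shared by the two sibling pairs. With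
  one in common in the same position, only the two others have to meet in a community; four distinct
  half-edges require two meetings, which gains a factor \<open>1 / h\<close>.\<close>

lemma prob_colliding_le:
  assumes "c \<in> siblings R D" "c' \<in> siblings R D"
  shows "Pr (\<lambda>\<omega>. colliding R K \<omega> (c, c')) \<le>
    4 * real K / h * of_bool (fst c' = fst c) + 4 * real K / h * of_bool (snd c' = snd c)
      + 16 * (real K)\<^sup>2 / h\<^sup>2"
proof -
  obtain p q where c: "c = (p, q)" "p \<in> l_half_edges R" "q \<in> l_half_edges R" "p \<noteq> q"
    using assms by (auto simp: siblings_def)
  obtain p' q' where c': "c' = (p', q')" "p' \<in> l_half_edges R" "q' \<in> l_half_edges R" "p' \<noteq> q'"
    using assms by (auto simp: siblings_def)
  have nonneg: "0 \<le> 4 * real K / h" "0 \<le> 16 * (real K)\<^sup>2 / h\<^sup>2"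
    using h_pos by auto
  have bound: "Pr (\<lambda>\<omega>. colliding R K \<omega> (c, c')) \<le> B"
    if "\<And>\<omega>. colliding R K \<omega> (c, c') \<Longrightarrow> Q \<omega>" "Pr Q \<le> B" for Q B
    using prob_random_matching_mono[OF card_eq, of "\<lambda>\<omega>. colliding R K \<omega> (c, c')" Q] that
    by (meson order.trans)
  consider (same) "c = c'" | (fst) "p' = p" "q' \<noteq> q" | (snd) "p' \<noteq> p" "q' = q"
    | (cross) "p' = q \<or> q' = p" "p' \<noteq> p" "q' \<noteq> q" | (dist) "distinct [p, p', q, q']"
    using c c' by force
  then show ?thesis
  proof cases
    case same
    have "Pr (\<lambda>\<omega>. colliding R K \<omega> (c, c')) = 0" using same by (simp add: colliding_def)
    then show ?thesis using nonneg by simp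
  next
    case fst
    have "Pr (\<lambda>\<omega>. colliding R K \<omega> (c, c')) \<le> 4 * real K / h"
    proof (rule bound[OF _ prob_twins_le])
      show "fst (\<omega> q) = fst (\<omega> q') \<and> rdeg R (fst (\<omega> q)) \<le> K" if "colliding R K \<omega> (c, c')" for \<omega>
        using that by (auto simp: colliding_def joined_def exceptional_def c c')
    qed (use c c' fst in auto)
    then show ?thesis using fst nonneg by (auto simp: c c' intro!: add_increasing2)
  next
    case snd
    have "Pr (\<lambda>\<omega>. colliding R K \<omega> (c, c')) \<le> 4 * real K / h"
    proof (rule bound[OF _ prob_twins_le])
      show "fst (\<omega> p) = fst (\<omega> p') \<and> rdeg R (fst (\<omega> p)) \<le> K" if "colliding R K \<omega> (c, c')" for \<omega>
        using that by (auto simp: colliding_def joined_def exceptional_def c c')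
    qed (use c c' snd in auto)
    then show ?thesis using snd nonneg by (auto simp: c c' intro!: add_increasing2)
  next
    \<comment> \<open>A half-edge shared in opposite positions would put both ends of
      \<open>c\<close> into one community, which makes \<open>c\<close> exceptional.\<close>
    case cross
    have "Pr (\<lambda>\<omega>. colliding R K \<omega> (c, c')) \<le> 0"
    proof (rule bound)
      show False if "colliding R K \<omega> (c, c')" for \<omega>
        using that cross by (auto simp: colliding_def joined_def exceptional_def c c')
    qed simp
    then show ?thesis using nonneg by (auto intro: order.trans)
  next
    case dist
    have "Pr (\<lambda>\<omega>. colliding R K \<omega> (c, c')) \<le> 16 * (real K)\<^sup>2 / h\<^sup>2"
    proof (rule bound[OF _ prob_two_twins_le])
      show "fst (\<omega> p) = fst (\<omega> p') \<and> rdeg R (fst (\<omega> p)) \<le> K \<and>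
          fst (\<omega> q) = fst (\<omega> q') \<and> rdeg R (fst (\<omega> q)) \<le> K" if "colliding R K \<omega> (c, c')" for \<omega>
        using that by (auto simp: colliding_def joined_def exceptional_def c c')
    qed (use c c' dist in auto)
    then show ?thesis using nonneg by (auto intro: order.trans)
  qed
qed

lemma prob_card_exceptional_ge:
  assumes "0 < t"
  shows "Pr (\<lambda>\<omega>. t \<le> real (card {c \<in> siblings R D. exceptional R K \<omega> c}))
    \<le> real (card (siblings R D)) * (4 * real (card (high_r R K)) / h + 4 * real K / h) / t"
proof -
  have "Pr (\<lambda>\<omega>. t \<le> real (card {c \<in> siblings R D. exceptional R K \<omega> c}))
      \<le> (\<Sum>c\<in>siblings R D. Pr (\<lambda>\<omega>. exceptional R K \<omega> c)) / t"
    by (rule prob_card_ge_le) (use assms in auto)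
  also have "\<dots> \<le> real (card (siblings R D)) * (4 * real (card (high_r R K)) / h + 4 * real K / h) / t"
    by (intro divide_right_mono sum_bounded_above prob_exceptional_le) (use assms in auto)
  finally show ?thesis .
qed

text \<open>For a given sibling pair, at most \<open>D\<close> members of
  \<open>siblings R D\<close> have the same first and at most \<open>D\<close> the same second
  half-edge, at a cost of \<open>4 K / h\<close> each. Beyond that, every partner costs only order
  \<open>1 / h^2\<close>.\<close>

lemma prob_card_collisions_ge:
  assumes "0 < t"
  shows "Pr (\<lambda>\<omega>. t \<le> real (card (collisions R D K \<omega>)))
    \<le> real (card (siblings R D)) * (8 * real D * real K / h
        + 16 * real (card (siblings R D)) * (real K)\<^sup>2 / h\<^sup>2) / t"
proof -
  let ?S = "siblings R D"
  let ?a = "4 * real K / h" and ?b = "16 * (real K)\<^sup>2 / h\<^sup>2"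
  have nonneg: "0 \<le> ?a" using h_pos by simp
  have count: "(\<Sum>c'\<in>?S. ?a * of_bool (Q c')) = ?a * real (card {c' \<in> ?S. Q c'})" for Q
    unfolding sum_distrib_left[symmetric] by (simp add: of_bool_def sum.If_cases Int_def)
  have inner: "(\<Sum>c'\<in>?S. Pr (\<lambda>\<omega>. colliding R K \<omega> (c, c'))) \<le>
      8 * real D * real K / h + 16 * real (card ?S) * (real K)\<^sup>2 / h\<^sup>2" if c: "c \<in> ?S" for c
  proof -
    have "(\<Sum>c'\<in>?S. Pr (\<lambda>\<omega>. colliding R K \<omega> (c, c'))) \<le>
        (\<Sum>c'\<in>?S. ?a * of_bool (fst c' = fst c) + ?a * of_bool (snd c' = snd c) + ?b)"
      by (rule sum_mono) (rule prob_colliding_le[OF c])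
    also have "\<dots> = ?a * real (card {c' \<in> ?S. fst c' = fst c})
        + ?a * real (card {c' \<in> ?S. snd c' = snd c}) + real (card ?S) * ?b"
      by (simp only: sum.distrib count sum_constant)
    also have "\<dots> \<le> ?a * real D + ?a * real D + real (card ?S) * ?b"
      using card_siblings_fst_eq_le[OF c] card_siblings_snd_eq_le[OF c] nonneg
      by (intro add_mono mult_left_mono) auto
    finally show ?thesis by (simp add: mult_ac)
  qed
  have "Pr (\<lambda>\<omega>. t \<le> real (card (collisions R D K \<omega>)))
      \<le> (\<Sum>x\<in>?S \<times> ?S. Pr (\<lambda>\<omega>. colliding R K \<omega> x)) / t"
    by (rule prob_card_ge_le) (use assms in auto)
  also have "(\<Sum>x\<in>?S \<times> ?S. Pr (\<lambda>\<omega>. colliding R K \<omega> x))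
      = (\<Sum>c\<in>?S. \<Sum>c'\<in>?S. Pr (\<lambda>\<omega>. colliding R K \<omega> (c, c')))"
    by (simp add: sum.cartesian_product case_prod_unfold)
  also have "\<dots> \<le> real (card ?S) * (8 * real D * real K / h
      + 16 * real (card ?S) * (real K)\<^sup>2 / h\<^sup>2)"
    by (rule sum_bounded_above[OF inner])
  finally show ?thesis using assms by (simp add: divide_right_mono)
qed

end

section \<open>Conditional probabilities as ratios of counts\<close>

lemma vertex_prob_eq:
  assumes "w \<in> set_pmf (random_matching R)" "individuals R \<noteq> {}"
  shows "vertex_prob R w = real (card {v \<in> individuals R. \<exists>a b. {a, b} \<in> overlapping_pairs R w 2 \<and>
      part_of R w v a \<and> part_of R w v b}) / real (num_l R)"
  unfolding vertex_prob_def individual_matching_def pair_pmf_eq_bind_map cond_prob_bind_pmf[OF assms(1)]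
  by (subst measure_pmf_of_set) (use assms(2) in \<open>auto simp: individuals_def Int_def\<close>)

lemma group_prob_eq:
  assumes "w \<in> set_pmf (random_matching R)" "communities R \<noteq> {}"
  shows "group_prob R w = real (card {a \<in> communities R. \<exists>b\<in>nbr_communities R w a.
      2 \<le> overlap R w a b}) / real (num_r R)"
  unfolding group_prob_def community_matching_def pair_pmf_eq_bind_map cond_prob_bind_pmf[OF assms(1)]
  by (subst measure_pmf_of_set) (use assms(2) in \<open>auto simp: communities_def Int_def\<close>)

lemma global_prob_eq:
  assumes "w \<in> set_pmf (random_matching R)"
  shows "global_prob R w =
    real (card (overlapping_pairs R w 2)) / real (card (overlapping_pairs R w 1))"
proof -
  let ?Q = "\<lambda>p. \<exists>a b. p = Some {a, b} \<and> 2 \<le> overlap R w a b"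
  have eq: "global_prob R w = measure_pmf.prob (random_overlapping_pair R w) {p. ?Q p}"
    unfolding global_prob_def pair_matching_def
    by (rule cond_prob_bind_pmf[OF assms, of "random_overlapping_pair R"
        "\<lambda>p \<omega>. \<exists>a b. p = Some {a, b} \<and> 2 \<le> overlap R \<omega> a b"])
  have sub: "overlapping_pairs R w 2 \<subseteq> overlapping_pairs R w 1"
    by (rule overlapping_pairs_antimono) simp
  show ?thesis
  proof (cases "overlapping_pairs R w 1 = {}")
    \<comment> \<open>No pair can be drawn: the event fails for \<open>None\<close>, and the
      quotient on the right is \<open>0 / 0\<close>, which is \<open>0\<close>.\<close>
    case True
    then show ?thesis by (simp add: eq random_overlapping_pair_def)
  next
    case False
    have "overlapping_pairs R w 1 \<inter> {e. ?Q (Some e)} = overlapping_pairs R w 2"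
    proof (intro equalityI subsetI)
      fix e assume "e \<in> overlapping_pairs R w 1 \<inter> {e. ?Q (Some e)}"
      then obtain a b where "{a, b} \<in> overlapping_pairs R w 1" "e = {a, b}" "2 \<le> overlap R w a b"
        by auto
      then show "e \<in> overlapping_pairs R w 2" by (simp add: mem_overlapping_pairs_iff)
    next
      fix e assume "e \<in> overlapping_pairs R w 2"
      then show "e \<in> overlapping_pairs R w 1 \<inter> {e. ?Q (Some e)}"
        using sub by (blast elim: overlapping_pairsE)
    qed
    with False show ?thesis
      by (simp add: eq random_overlapping_pair_def vimage_def measure_pmf_of_set)
  qed
qed

section \<open>Uniform integrability of the degrees\<close>

text \<open>Weak convergence yields convergence of the mean clipped degree and, with convergence of
  the means, of the mean excess over the clipping level \<open>K\<close>, which is small for large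
  \<open>K\<close>. A degree above \<open>2 K\<close> is at most twice its excess.\<close>

lemma high_l_tail:
  fixes R :: "nat \<Rightarrow> rigc_params" and P :: "'p measure" and Dl :: "'p \<Rightarrow> real" and e :: real
  assumes N: "filterlim (\<lambda>n. num_l (R n)) at_top sequentially"
    and P: "prob_space P" and Dl: "Dl \<in> borel_measurable P"
    and weak: "weak_conv_m
              (\<lambda>n. distr (measure_pmf (pmf_of_set (individuals (R n)))) borel
                      (\<lambda>v. real (ldeg (R n) v)))
              (distr P borel Dl)"
    and int: "integrable P Dl"
    and mean: "(\<lambda>n. measure_pmf.expectation (pmf_of_set (individuals (R n)))
                   (\<lambda>v. real (ldeg (R n) v)))
              \<longlonglongrightarrow> prob_space.expectation P Dl"
    and e: "0 < e"
  shows "\<exists>D. \<forall>\<^sub>F n in sequentially. real (card (high_l (R n) D)) \<le> e * real (num_l (R n))"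
proof -
  interpret P: prob_space P by fact
  \<comment> \<open>Bounded and continuous, hence a test function for weak convergence; the lower
    cut bounds it on the whole real line.\<close>
  define clip :: "nat \<Rightarrow> real \<Rightarrow> real" where "clip K x = max (- real K) (min (real K) x)" for K x
  have clip_cont: "isCont (clip K) x" for K x
    unfolding clip_def by (intro continuous_intros)
  have [measurable]: "clip K \<in> borel_measurable borel" for K
    unfolding clip_def by measurable
  note [measurable] = Dl
  have "(\<lambda>K. \<integral>x. clip K (Dl x) \<partial>P) \<longlonglongrightarrow> (\<integral>x. Dl x \<partial>P)"
  proof (rule integral_dominated_convergence[where w = "\<lambda>x. \<bar>Dl x\<bar>"])
    show "AE x in P. (\<lambda>K. clip K (Dl x)) \<longlonglongrightarrow> Dl x"
    proof (rule AE_I2)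
      fix x
      obtain k :: nat where "\<bar>Dl x\<bar> \<le> real k" using real_arch_simple by blast
      then have "\<forall>\<^sub>F K in sequentially. clip K (Dl x) = Dl x"
        by (intro eventually_sequentiallyI[of k]) (auto simp: clip_def)
      then show "(\<lambda>K. clip K (Dl x)) \<longlonglongrightarrow> Dl x"
        by (rule tendsto_eventually)
    qed
    show "AE x in P. norm (clip K (Dl x)) \<le> \<bar>Dl x\<bar>" for K
      by (auto simp: clip_def)
  qed (use int in auto)
  \<comment> \<open>Errors of \<open>e / 6\<close> here and in the convergence of the means leave an
    excess below \<open>e / 3\<close>, and twice that is still below \<open>e\<close>.\<close>
  from order_tendstoD(1)[OF this, of "(\<integral>x. Dl x \<partial>P) - e / 6"] e
  obtain K where K: "(\<integral>x. Dl x \<partial>P) - e / 6 < (\<integral>x. clip K (Dl x) \<partial>P)"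
    by (auto simp: eventually_sequentially)
  let ?E = "\<lambda>n. measure_pmf.expectation (pmf_of_set (individuals (R n)))"
  have "(\<lambda>n. integral\<^sup>L (distr (measure_pmf (pmf_of_set (individuals (R n)))) borel
        (\<lambda>v. real (ldeg (R n) v))) (clip K)) \<longlonglongrightarrow> integral\<^sup>L (distr P borel Dl) (clip K)"
    by (rule weak_conv_imp_integral_bdd_continuous_conv[OF _ _ weak clip_cont, where B = "real K"])
       (auto simp: clip_def intro!: prob_space.real_distribution_distr[OF measure_pmf.prob_space_axioms]
         P.real_distribution_distr)
  then have conv: "(\<lambda>n. ?E n (\<lambda>v. clip K (real (ldeg (R n) v)))) \<longlonglongrightarrow> (\<integral>x. clip K (Dl x) \<partial>P)"
    by (simp add: integral_distr)
  have "\<forall>\<^sub>F n in sequentially. real (card (high_l (R n) (2 * K))) \<le> e * real (num_l (R n))"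
    using order_tendstoD(1)[OF conv K]
      order_tendstoD(2)[OF mean, of "(\<integral>x. Dl x \<partial>P) + e / 6", simplified, OF e]
      filterlim_at_top[THEN iffD1, OF N, rule_format, of 1]
  proof eventually_elim
    case (elim n)
    let ?I = "individuals (R n)" and ?d = "\<lambda>v. real (ldeg (R n) v)"
    have ne: "?I \<noteq> {}" and cI: "card ?I = num_l (R n)"
      using elim(3) by (auto simp: individuals_def)
    note E = integral_pmf_of_set[OF ne finite_individuals_communities(1), unfolded cI]
    have "real (card (high_l (R n) (2 * K))) = (\<Sum>v | v \<in> ?I \<and> 2 * K < ldeg (R n) v. ?d v)"
      by (simp add: card_high_l)
    also have "\<dots> \<le> (\<Sum>v | v \<in> ?I \<and> 2 * K < ldeg (R n) v. 2 * (?d v - clip K (?d v)))"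
      by (rule sum_mono) (auto simp: clip_def)
    also have "\<dots> \<le> (\<Sum>v\<in>?I. 2 * (?d v - clip K (?d v)))"
      by (rule sum_mono2) (auto simp: clip_def)
    also have "\<dots> = 2 * (?E n ?d - ?E n (\<lambda>v. clip K (?d v))) * real (num_l (R n))"
      using elim(3) by (simp add: E sum_distrib_left[symmetric] sum_subtractf field_simps)
    also have "\<dots> \<le> e * real (num_l (R n))"
      using elim(1,2) e by (intro mult_right_mono) auto
    finally show ?case .
  qed
  then show ?thesis ..
qed

text \<open>The support is countable: initial segments of an enumeration exhaust it, and dominated
  convergence carries the expectation along.\<close>

lemma pmf_expectation_finite_approx:
  fixes p :: "'a pmf" and f :: "'a \<Rightarrow> real"
  assumes int: "integrable (measure_pmf p) f" and e: "0 < e"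
  shows "\<exists>F. finite F \<and> F \<subseteq> set_pmf p \<and> measure_pmf.expectation p f - e < (\<Sum>x\<in>F. pmf p x * f x)"
proof -
  define F where "F k = from_nat_into (set_pmf p) ` {..<k}" for k
  have "(\<lambda>k. \<integral>x. indicator (F k) x * f x \<partial>measure_pmf p) \<longlonglongrightarrow> (\<integral>x. f x \<partial>measure_pmf p)"
  proof (rule integral_dominated_convergence[where w = "\<lambda>x. \<bar>f x\<bar>"])
    show "AE x in measure_pmf p. (\<lambda>k. indicator (F k) x * f x) \<longlonglongrightarrow> f x"
    proof (rule AE_pmfI)
      fix x assume "x \<in> set_pmf p"
      then obtain k where "x = from_nat_into (set_pmf p) k"
        using from_nat_into_surj[OF countable_set_pmf] by metis
      then have "\<forall>\<^sub>F k in sequentially. indicator (F k) x * f x = f x"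
        by (intro eventually_sequentiallyI[of "Suc k"]) (auto simp: F_def indicator_def)
      then show "(\<lambda>k. indicator (F k) x * f x) \<longlonglongrightarrow> f x"
        by (rule tendsto_eventually)
    qed
  qed (use int in \<open>auto simp: indicator_def\<close>)
  from order_tendstoD(1)[OF this, of "measure_pmf.expectation p f - e"] e
  obtain k where k: "measure_pmf.expectation p f - e < (\<integral>x. indicator (F k) x * f x \<partial>measure_pmf p)"
    by (auto simp: eventually_sequentially)
  have "(\<integral>x. indicator (F k) x * f x \<partial>measure_pmf p) = (\<Sum>x\<in>F k. pmf p x * f x)"
    by (subst integral_measure_pmf[of "F k"]) (auto simp: F_def indicator_def intro!: sum.cong)
  moreover have "finite (F k)" "F k \<subseteq> set_pmf p"
    by (auto simp: F_def from_nat_into set_pmf_not_empty)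
  ultimately show ?thesis using k by auto
qed

text \<open>Finitely many graphs carry all but \<open>e / 2\<close> of the mean size under
  \<open>\<mu>\<close>, and their frequencies converge. Since the mean sizes converge too, the other
  communities, among them all of size above \<open>K\<close>, eventually contribute at most
  \<open>e\<close> to the mean.\<close>

lemma high_r_tail:
  fixes R :: "nat \<Rightarrow> rigc_params" and \<mu> :: "nat pair_pre_digraph pmf" and e :: real
  assumes M: "filterlim (\<lambda>n. num_r (R n)) at_top sequentially"
    and \<mu>: "set_pmf \<mu> \<subseteq> \<H>"
    and freq: "\<And>H. H \<in> \<H> \<Longrightarrow>
              (\<lambda>n. real (card {a \<in> communities (R n). com (R n) a = H}) / real (num_r (R n)))
                \<longlonglongrightarrow> pmf \<mu> H"
    and int: "integrable (measure_pmf (map_pmf gsize \<mu>)) real"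
    and mean: "(\<lambda>n. measure_pmf.expectation (pmf_of_set (communities (R n)))
                   (\<lambda>a. real (rdeg (R n) a)))
              \<longlonglongrightarrow> measure_pmf.expectation (map_pmf gsize \<mu>) real"
    and e: "0 < e"
  shows "\<exists>K. \<forall>\<^sub>F n in sequentially. real (card (high_r (R n) K)) \<le> e * real (num_r (R n))"
proof -
  let ?m = "measure_pmf.expectation \<mu> (\<lambda>H. real (gsize H))"
  let ?E = "\<lambda>n. measure_pmf.expectation (pmf_of_set (communities (R n))) (\<lambda>a. real (rdeg (R n) a))"
  have mean': "?E \<longlonglongrightarrow> ?m" using mean by simp
  have int': "integrable (measure_pmf \<mu>) (\<lambda>H. real (gsize H))"
    using int by (simp add: integrable_map_pmf_eq)
  obtain F where F: "finite F" "F \<subseteq> set_pmf \<mu>" "?m - e / 2 < (\<Sum>H\<in>F. pmf \<mu> H * real (gsize H))"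
    using pmf_expectation_finite_approx[OF int', of "e / 2"] e by auto
  \<comment> \<open>An upper bound for the sizes of the graphs in \<open>F\<close> that also makes
    sense for empty \<open>F\<close>.\<close>
  define K where "K = (\<Sum>H\<in>F. gsize H)"
  let ?f = "\<lambda>n H. real (card {a \<in> communities (R n). com (R n) a = H}) / real (num_r (R n))"
  have "(\<lambda>n. \<Sum>H\<in>F. ?f n H * real (gsize H)) \<longlonglongrightarrow> (\<Sum>H\<in>F. pmf \<mu> H * real (gsize H))"
    using F(2) \<mu> by (intro tendsto_intros freq) auto
  note conv = order_tendstoD(1)[OF this F(3)]
  have "\<forall>\<^sub>F n in sequentially. real (card (high_r (R n) K)) \<le> e * real (num_r (R n))"
    using conv order_tendstoD(2)[OF mean', of "?m + e / 2", simplified, OF e]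
      filterlim_at_top[THEN iffD1, OF M, rule_format, of 1]
  proof eventually_elim
    case (elim n)
    let ?C = "communities (R n)" and ?d = "rdeg (R n)"
    have ne: "?C \<noteq> {}" and cC: "card ?C = num_r (R n)"
      using elim(3) by (auto simp: communities_def)
    note E = integral_pmf_of_set[OF ne finite_individuals_communities(2), unfolded cC]
    have "(\<Sum>H\<in>F. card {a \<in> ?C. com (R n) a = H} * gsize H) =
        (\<Sum>H\<in>F. \<Sum>a | a \<in> {a \<in> ?C. com (R n) a \<in> F} \<and> com (R n) a = H. ?d a)"
    proof (rule sum.cong)
      fix H assume "H \<in> F"
      then have "{a. a \<in> {a \<in> ?C. com (R n) a \<in> F} \<and> com (R n) a = H} = {a \<in> ?C. com (R n) a = H}"
        by auto
      then show "card {a \<in> ?C. com (R n) a = H} * gsize H =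
          (\<Sum>a | a \<in> {a \<in> ?C. com (R n) a \<in> F} \<and> com (R n) a = H. ?d a)"
        by (simp add: rdeg_def)
    qed simp
    also have "\<dots> = (\<Sum>a\<in>{a \<in> ?C. com (R n) a \<in> F}. ?d a)"
      by (rule sum.group) (use F in auto)
    also have "\<dots> \<le> (\<Sum>a\<in>?C - {a \<in> ?C. K < ?d a}. ?d a)"
    proof (rule sum_mono2)
      show "{a \<in> ?C. com (R n) a \<in> F} \<subseteq> ?C - {a \<in> ?C. K < ?d a}"
        using member_le_sum[of _ F gsize] F(1) by (fastforce simp: K_def rdeg_def)
    qed auto
    finally have "(\<Sum>H\<in>F. card {a \<in> ?C. com (R n) a = H} * gsize H) + card (high_r (R n) K)
        \<le> (\<Sum>a\<in>?C. ?d a)"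
      using sum.subset_diff[of "{a \<in> ?C. K < ?d a}" ?C ?d] by (simp add: card_high_r)
    then have "(\<Sum>H\<in>F. real (card {a \<in> ?C. com (R n) a = H}) * real (gsize H))
        + real (card (high_r (R n) K)) \<le> (\<Sum>a\<in>?C. real (?d a))"
      unfolding of_nat_mult[symmetric] of_nat_sum[symmetric] of_nat_add[symmetric] of_nat_le_iff .
    moreover have "(\<Sum>H\<in>F. real (card {a \<in> ?C. com (R n) a = H}) * real (gsize H))
        = (\<Sum>H\<in>F. ?f n H * real (gsize H)) * real (num_r (R n))"
      using elim(3) by (simp add: sum_distrib_right)
    moreover have "(\<Sum>a\<in>?C. real (?d a)) = ?E n * real (num_r (R n))"
      using elim(3) by (simp add: E)
    ultimately have "real (card (high_r (R n) K))
        \<le> (?E n - (\<Sum>H\<in>F. ?f n H * real (gsize H))) * real (num_r (R n))"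
      by (simp add: left_diff_distrib)
    also have "\<dots> \<le> e * real (num_r (R n))"
      using elim(1,2) by (intro mult_right_mono) auto
    finally show ?case .
  qed
  then show ?thesis ..
qed

section \<open>Limits\<close>

text \<open>The deterministic facts behind the limit statements: the numbers of individuals,
  communities and half-edges are of the same order, and half-edges at high degrees form a small
  fraction.\<close>

locale rigc_sequence =
  fixes R :: "nat \<Rightarrow> rigc_params"
  assumes balanced: "\<And>n. card (l_half_edges (R n)) = card (r_half_edges (R n))"
    and num_l_le: "\<And>n. num_l (R n) \<le> card (l_half_edges (R n))"
    and num_r_le: "\<And>n. num_r (R n) \<le> card (l_half_edges (R n))"
    and num_l_at_top: "filterlim (\<lambda>n. num_l (R n)) at_top sequentially"
    and num_r_at_top: "filterlim (\<lambda>n. num_r (R n)) at_top sequentially"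
    and half_edges_le_num_l:
      "\<exists>B>0. \<forall>\<^sub>F n in sequentially. real (card (l_half_edges (R n))) \<le> B * real (num_l (R n))"
    and half_edges_le_num_r:
      "\<exists>B>0. \<forall>\<^sub>F n in sequentially. real (card (l_half_edges (R n))) \<le> B * real (num_r (R n))"
    and high_l_small:
      "\<And>e. 0 < e \<Longrightarrow>
         \<exists>D. \<forall>\<^sub>F n in sequentially. real (card (high_l (R n) D)) \<le> e * real (num_l (R n))"
    and high_r_small:
      "\<And>e. 0 < e \<Longrightarrow>
         \<exists>K. \<forall>\<^sub>F n in sequentially. real (card (high_r (R n) K)) \<le> e * real (num_r (R n))"
begin

lemma support: "set_pmf (random_matching (R n)) = matchings (R n)"
  by (rule set_pmf_random_matching[OF balanced])

lemma eventually_num_ge: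
  "\<forall>\<^sub>F n in sequentially. k \<le> num_l (R n)" "\<forall>\<^sub>F n in sequentially. k \<le> num_r (R n)"
  using num_l_at_top num_r_at_top by (auto simp: filterlim_at_top)

text \<open>For fixed \<open>D\<close> and \<open>K\<close> the expected number of collisions is
  bounded, since there are at most \<open>h D\<close> sibling pairs, whereas the threshold tends to
  infinity. \<open>Z\<close> will be the number of individuals or of communities.\<close>

lemma collisions_tendsto:
  assumes Z: "filterlim Z at_top sequentially" and Z_le: "\<And>n. Z n \<le> card (l_half_edges (R n))"
    and c: "0 < c"
  shows "(\<lambda>n. measure_pmf.prob (random_matching (R n))
      {\<omega>. c * real (Z n) \<le> real (card (collisions (R n) D K \<omega>))}) \<longlonglongrightarrow> 0"
proof (rule tendsto_sandwich[OF _ _ tendsto_const])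
  \<comment> \<open>The expectation bound in \<open>prob_card_collisions_ge\<close> with
    \<open>h * real D\<close> for the number of sibling pairs; all powers of \<open>h\<close>
    cancel.\<close>
  let ?C = "8 * (real D)\<^sup>2 * real K + 16 * (real D)\<^sup>2 * (real K)\<^sup>2"
  have Z': "filterlim (\<lambda>n. real (Z n)) at_top sequentially"
    using Z by (rule filterlim_compose[OF filterlim_real_sequentially])
  show "(\<lambda>n. ?C / (c * real (Z n))) \<longlonglongrightarrow> 0"
    by (intro real_tendsto_divide_at_top[OF tendsto_const]
        filterlim_tendsto_pos_mult_at_top[OF tendsto_const c Z'])
  show "\<forall>\<^sub>F n in sequentially. measure_pmf.prob (random_matching (R n))
      {\<omega>. c * real (Z n) \<le> real (card (collisions (R n) D K \<omega>))} \<le> ?C / (c * real (Z n))"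
    using filterlim_at_top[THEN iffD1, OF Z, rule_format, of 6]
  proof eventually_elim
    case (elim n)
    define h where "h = real (card (l_half_edges (R n)))"
    have h: "6 \<le> card (l_half_edges (R n))" "0 < h"
      using elim Z_le[of n] by (auto simp: h_def)
    let ?S = "real (card (siblings (R n) D))"
    have S: "?S \<le> h * real D"
      using of_nat_mono[OF card_siblings_le[of "R n" D], where 'a = real] by (simp add: h_def)
    have t: "0 < c * real (Z n)" using c elim by simp
    have "measure_pmf.prob (random_matching (R n))
      {\<omega>. c * real (Z n) \<le> real (card (collisions (R n) D K \<omega>))}
      \<le> ?S * (8 * real D * real K / h + 16 * ?S * (real K)\<^sup>2 / h\<^sup>2) / (c * real (Z n))"
      using prob_card_collisions_ge[OF balanced h(1) t, of D K] unfolding h_def by simp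
    also have "\<dots> \<le> (h * real D) * (8 * real D * real K / h
        + 16 * (h * real D) * (real K)\<^sup>2 / h\<^sup>2) / (c * real (Z n))"
      using S t h(2)
      by (intro divide_right_mono mult_mono add_mono mult_left_mono mult_right_mono order.refl) auto
    also have "\<dots> = ?C / (c * real (Z n))"
      using h(2) c elim by (simp add: field_simps power2_eq_square)
    finally show ?case .
  qed
qed auto

text \<open>In \<open>card_vertex_bad_le\<close> the high roles and the high half-edges each receive
  a quarter of \<open>\<epsilon>\<close> times the number of individuals, so a bad matching must
  have collisions for the remaining half.\<close>

lemma vertex_prob_tendsto:
  "tendsto_in_prob (\<lambda>n. random_matching (R n)) (\<lambda>n. vertex_prob (R n)) 0"
  unfolding tendsto_in_prob_def
proof (intro allI impI)
  fix \<epsilon> :: real assume \<epsilon>: "0 < \<epsilon>"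
  obtain B where B: "0 < B"
    "\<forall>\<^sub>F n in sequentially. real (card (l_half_edges (R n))) \<le> B * real (num_l (R n))"
    using half_edges_le_num_l by auto
  \<comment> \<open>\<open>K\<close> precedes \<open>D\<close> because the choice of
    \<open>D\<close> has to absorb the factor \<open>1 + K\<close>.\<close>
  obtain K where K: "\<forall>\<^sub>F n in sequentially.
      real (card (high_r (R n) K)) \<le> \<epsilon> / (4 * B) * real (num_r (R n))"
    using high_r_small[of "\<epsilon> / (4 * B)"] \<epsilon> B(1) by auto
  obtain D where D: "\<forall>\<^sub>F n in sequentially.
      real (card (high_l (R n) D)) \<le> \<epsilon> / (4 * (1 + real K)) * real (num_l (R n))"
    using high_l_small[of "\<epsilon> / (4 * (1 + real K))"] \<epsilon> by auto
  have "\<forall>\<^sub>F n in sequentially.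
      \<P>(\<omega> in random_matching (R n). \<epsilon> < \<bar>vertex_prob (R n) \<omega> - 0\<bar>)
      \<le> measure_pmf.prob (random_matching (R n))
        {\<omega>. \<epsilon> / 2 * real (num_l (R n)) \<le> real (card (collisions (R n) D K \<omega>))}"
    using B(2) K D eventually_num_ge(1)[of 1]
  proof eventually_elim
    case (elim n)
    let ?N = "real (num_l (R n))"
    have N: "0 < ?N" "individuals (R n) \<noteq> {}"
      using elim(4) by (auto simp: individuals_def)
    \<comment> \<open>Converts a fraction of the communities into one of the individuals:
      \<open>num_r\<close> is at most the number of half-edges, hence at most
      \<open>B * ?N\<close>.\<close>
    have "\<epsilon> / (4 * B) * real (num_r (R n)) \<le> \<epsilon> / (4 * B) * (B * ?N)"
      using num_r_le[of n] elim(1) \<epsilon> B(1) by (intro mult_left_mono) auto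
    with elim(2) B(1) have hr: "real (card (high_r (R n) K)) \<le> \<epsilon> / 4 * ?N" by simp
    have "real (card (high_l (R n) D)) * (1 + real K)
        \<le> \<epsilon> / (4 * (1 + real K)) * ?N * (1 + real K)"
      using elim(3) by (intro mult_right_mono) auto
    also have "\<dots> = \<epsilon> / 4 * ?N"
      by (simp add: field_simps add_nonneg_eq_0_iff)
    finally have hl: "real (card (high_l (R n) D)) * (1 + real K) \<le> \<epsilon> / 4 * ?N" .
    have "measure_pmf.prob (random_matching (R n)) {\<omega>. \<epsilon> < \<bar>vertex_prob (R n) \<omega> - 0\<bar>}
      \<le> measure_pmf.prob (random_matching (R n))
        {\<omega>. \<epsilon> / 2 * ?N \<le> real (card (collisions (R n) D K \<omega>))}"
    proof (rule prob_random_matching_mono[OF balanced])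
      fix \<omega> assume \<omega>: "\<omega> \<in> matchings (R n)" and gt: "\<epsilon> < \<bar>vertex_prob (R n) \<omega> - 0\<bar>"
      define b where "b = card {v \<in> individuals (R n). \<exists>a b. {a, b} \<in> overlapping_pairs (R n) \<omega> 2 \<and>
          part_of (R n) \<omega> v a \<and> part_of (R n) \<omega> v b}"
      have "vertex_prob (R n) \<omega> = real b / ?N"
        unfolding b_def by (rule vertex_prob_eq) (use \<omega> N support in auto)
      with gt N(1) have "\<epsilon> * ?N < real b" by (simp add: field_simps)
      moreover have "real b \<le> real (card (high_r (R n) K)) +
          real (card (high_l (R n) D)) * (1 + real K) + real (card (collisions (R n) D K \<omega>))"
        using of_nat_mono[OF card_vertex_bad_le[OF \<omega>, of K D], where 'a = real]
        by (simp add: b_def algebra_simps)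
      ultimately show "\<epsilon> / 2 * ?N \<le> real (card (collisions (R n) D K \<omega>))"
        using hr hl by linarith
    qed
    then show ?case by simp
  qed
  then show "(\<lambda>n. \<P>(\<omega> in random_matching (R n). \<epsilon> < \<bar>vertex_prob (R n) \<omega> - 0\<bar>)) \<longlonglongrightarrow> 0"
    by (rule tendsto_sandwich[OF _ _ tendsto_const collisions_tendsto[OF num_l_at_top num_l_le], rotated])
       (use \<epsilon> in auto)
qed

text \<open>Mirror image of the vertex perspective. In \<open>card_group_bad_le\<close> the count of
  high roles carries a factor \<open>1 + D\<close>, so \<open>D\<close> is chosen before
  \<open>K\<close>.\<close>

lemma group_prob_tendsto:
  "tendsto_in_prob (\<lambda>n. random_matching (R n)) (\<lambda>n. group_prob (R n)) 0"
  unfolding tendsto_in_prob_def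
proof (intro allI impI)
  fix \<epsilon> :: real assume \<epsilon>: "0 < \<epsilon>"
  obtain B where B: "0 < B"
    "\<forall>\<^sub>F n in sequentially. real (card (l_half_edges (R n))) \<le> B * real (num_r (R n))"
    using half_edges_le_num_r by auto
  obtain D where D: "\<forall>\<^sub>F n in sequentially.
      real (card (high_l (R n) D)) \<le> \<epsilon> / (4 * B) * real (num_l (R n))"
    using high_l_small[of "\<epsilon> / (4 * B)"] \<epsilon> B(1) by auto
  obtain K where K: "\<forall>\<^sub>F n in sequentially.
      real (card (high_r (R n) K)) \<le> \<epsilon> / (4 * (1 + real D)) * real (num_r (R n))"
    using high_r_small[of "\<epsilon> / (4 * (1 + real D))"] \<epsilon> by auto
  have "\<forall>\<^sub>F n in sequentially.
      \<P>(\<omega> in random_matching (R n). \<epsilon> < \<bar>group_prob (R n) \<omega> - 0\<bar>)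
      \<le> measure_pmf.prob (random_matching (R n))
        {\<omega>. \<epsilon> / 2 * real (num_r (R n)) \<le> real (card (collisions (R n) D K \<omega>))}"
    using B(2) K D eventually_num_ge(2)[of 1]
  proof eventually_elim
    case (elim n)
    let ?M = "real (num_r (R n))"
    have M: "0 < ?M" "communities (R n) \<noteq> {}"
      using elim(4) by (auto simp: communities_def)
    have "\<epsilon> / (4 * B) * real (num_l (R n)) \<le> \<epsilon> / (4 * B) * (B * ?M)"
      using num_l_le[of n] elim(1) \<epsilon> B(1) by (intro mult_left_mono) auto
    with elim(3) B(1) have hl: "real (card (high_l (R n) D)) \<le> \<epsilon> / 4 * ?M" by simp
    have "real (card (high_r (R n) K)) * (1 + real D)
        \<le> \<epsilon> / (4 * (1 + real D)) * ?M * (1 + real D)"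
      using elim(2) by (intro mult_right_mono) auto
    also have "\<dots> = \<epsilon> / 4 * ?M"
      by (simp add: field_simps add_nonneg_eq_0_iff)
    finally have hr: "real (card (high_r (R n) K)) * (1 + real D) \<le> \<epsilon> / 4 * ?M" .
    have "measure_pmf.prob (random_matching (R n)) {\<omega>. \<epsilon> < \<bar>group_prob (R n) \<omega> - 0\<bar>}
      \<le> measure_pmf.prob (random_matching (R n))
        {\<omega>. \<epsilon> / 2 * ?M \<le> real (card (collisions (R n) D K \<omega>))}"
    proof (rule prob_random_matching_mono[OF balanced])
      fix \<omega> assume \<omega>: "\<omega> \<in> matchings (R n)" and gt: "\<epsilon> < \<bar>group_prob (R n) \<omega> - 0\<bar>"
      define b where "b = card {a \<in> communities (R n). \<exists>b\<in>nbr_communities (R n) \<omega> a.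
          2 \<le> overlap (R n) \<omega> a b}"
      have "group_prob (R n) \<omega> = real b / ?M"
        unfolding b_def by (rule group_prob_eq) (use \<omega> M support in auto)
      with gt M(1) have "\<epsilon> * ?M < real b" by (simp add: field_simps)
      moreover have "real b \<le> real (card (high_r (R n) K)) * (1 + real D) +
          real (card (high_l (R n) D)) + real (card (collisions (R n) D K \<omega>))"
        using of_nat_mono[OF card_group_bad_le[OF \<omega>, of K D], where 'a = real]
        by (simp add: b_def algebra_simps)
      ultimately show "\<epsilon> / 2 * ?M \<le> real (card (collisions (R n) D K \<omega>))"
        using hr hl by linarith
    qed
    then show ?case by simp
  qed
  then show "(\<lambda>n. \<P>(\<omega> in random_matching (R n). \<epsilon> < \<bar>group_prob (R n) \<omega> - 0\<bar>)) \<longlonglongrightarrow> 0"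
    by (rule tendsto_sandwich[OF _ _ tendsto_const collisions_tendsto[OF num_r_at_top num_r_le], rotated])
       (use \<epsilon> in auto)
qed

lemma global_prob_tendsto:
  assumes sq: "\<forall>\<^sub>F n in sequentially.
      (\<Sum>v\<in>individuals (R n). (real (ldeg (R n) v))\<^sup>2) \<le> B * real (num_l (R n))"
    and B: "0 < B"
  shows "tendsto_in_prob (\<lambda>n. random_matching (R n)) (\<lambda>n. global_prob (R n)) 0"
  unfolding tendsto_in_prob_def
proof (intro allI impI)
  fix \<epsilon> :: real assume \<epsilon>: "0 < \<epsilon>"
  \<comment> \<open>The tolerated fraction of spoilt sibling pairs: \<open>1 / 2\<close> gives
    \<open>S \<le> 4 * y\<close> for the number \<open>y\<close> of overlapping pairs, and
    \<open>\<epsilon> / 4\<close> then brings the ratio below \<open>\<epsilon>\<close>.\<close>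
  define \<theta> where "\<theta> = min (\<epsilon> / 4) (1 / 2)"
  have \<theta>: "0 < \<theta>" "\<theta> \<le> 1 / 2" "4 * \<theta> \<le> \<epsilon>"
    using \<epsilon> by (auto simp: \<theta>_def)
  show "(\<lambda>n. \<P>(\<omega> in random_matching (R n). \<epsilon> < \<bar>global_prob (R n) \<omega> - 0\<bar>)) \<longlonglongrightarrow> 0"
  proof (rule order_tendstoI)
    fix \<zeta> :: real assume \<zeta>: "0 < \<zeta>"
    \<comment> \<open>Chosen so that the high roles contribute
      \<open>2 / \<theta> * 4 * (\<zeta> * \<theta> / 16) = \<zeta> / 2\<close> to the final
      bound.\<close>
    obtain K where K: "\<forall>\<^sub>F n in sequentially.
        real (card (high_r (R n) K)) \<le> \<zeta> * \<theta> / 16 * real (num_r (R n))"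
      using high_r_small[of "\<zeta> * \<theta> / 16"] \<zeta> \<theta> by auto
    let ?h = "\<lambda>n. real (card (l_half_edges (R n)))"
    \<comment> \<open>The final bound as a function of \<open>x = h\<close>, with
      \<open>sqrt (B * x)\<close> for \<open>D\<close> and \<open>B * x\<close> for the number of
      sibling pairs.\<close>
    let ?g = "\<lambda>x. 2 / \<theta> * (8 * sqrt (B * x) * real K / x + 16 * (B * x) * (real K)\<^sup>2 / x\<^sup>2
        + (4 * (\<zeta> * \<theta> / 16) + 4 * real K / x))"
    have h_top: "filterlim ?h at_top sequentially"
      by (rule filterlim_at_top_mono[OF filterlim_compose[OF filterlim_real_sequentially num_l_at_top]])
         (simp add: num_l_le)
    have "(?g \<longlongrightarrow> 2 / \<theta> * (0 + 0 + (4 * (\<zeta> * \<theta> / 16) + 0))) at_top"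
      using B by (intro tendsto_intros) real_asymp+
    then have "(?g \<longlongrightarrow> \<zeta> / 2) at_top"
      using \<theta> by simp
    from filterlim_compose[OF this h_top] have "\<forall>\<^sub>F n in sequentially. ?g (?h n) < \<zeta>"
      by (rule order_tendstoD) (use \<zeta> in auto)
    then show "\<forall>\<^sub>F n in sequentially.
        \<P>(\<omega> in random_matching (R n). \<epsilon> < \<bar>global_prob (R n) \<omega> - 0\<bar>) < \<zeta>"
      using sq K eventually_num_ge(1)[of 6]
    proof eventually_elim
      case (elim n)
      let ?Pr = "\<lambda>Q. measure_pmf.prob (random_matching (R n)) {\<omega>. Q \<omega>}"
      define h where "h = ?h n"
      have h6: "6 \<le> card (l_half_edges (R n))" using elim(4) num_l_le[of n] by simp
      then have h: "0 < h" by (simp add: h_def)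
      \<comment> \<open>large enough to exceed every degree, yet \<open>D / h\<close> tends to \<open>0\<close>\<close>
      define D where "D = nat \<lfloor>sqrt (B * h)\<rfloor>"
      have D_le: "real D \<le> sqrt (B * h)" unfolding D_def using B h by simp
      have sq_h: "(\<Sum>v\<in>individuals (R n). (real (ldeg (R n) v))\<^sup>2) \<le> B * h"
        using elim(2) num_l_le[of n] B by (simp add: h_def) (meson mult_left_mono of_nat_le_iff order.trans less_imp_le)
      have ldeg_le: "ldeg (R n) v \<le> D" if "v \<in> individuals (R n)" for v
      proof -
        have "(real (ldeg (R n) v))\<^sup>2 \<le> (\<Sum>v\<in>individuals (R n). (real (ldeg (R n) v))\<^sup>2)"
          using that by (intro member_le_sum) auto
        with sq_h have "real (ldeg (R n) v) \<le> sqrt (B * h)"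
          by (intro real_le_rsqrt) simp
        then show ?thesis unfolding D_def by (rule le_nat_floor)
      qed
      define S where "S = real (card (siblings (R n) D))"
      have S_le: "S \<le> B * h"
        using of_nat_mono[OF card_siblings_le_sum_squares[of "R n" D], where 'a = real] sq_h
        by (simp add: S_def)
      let ?exc = "\<lambda>\<omega>. real (card {c \<in> siblings (R n) D. exceptional (R n) K \<omega> c})"
      let ?col = "\<lambda>\<omega>. real (card (collisions (R n) D K \<omega>))"
      \<comment> \<open>The deterministic half of the argument: at most \<open>\<theta> * S\<close>
        exceptional pairs and collisions bound the numerator by \<open>\<theta> * S\<close> and the
        denominator below by \<open>S / 4\<close>.\<close>
      have ratio: "global_prob (R n) \<omega> \<le> \<epsilon>"
        if \<omega>: "\<omega> \<in> matchings (R n)" and le: "?exc \<omega> + ?col \<omega> \<le> \<theta> * S" for \<omega>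
      proof -
        define x y where "x = real (card (overlapping_pairs (R n) \<omega> 2))"
          and "y = real (card (overlapping_pairs (R n) \<omega> 1))"
        have eq: "global_prob (R n) \<omega> = x / y"
          unfolding x_def y_def by (rule global_prob_eq) (simp add: support \<omega>)
        have "x \<le> ?exc \<omega> + ?col \<omega>"
          using of_nat_mono[OF card_overlapping_pairs_2_le[OF \<omega> ldeg_le, of K], where 'a = real]
          by (simp add: x_def)
        then have x: "x \<le> \<theta> * S" using le by simp
        have "S \<le> 2 * y + ?exc \<omega> + ?col \<omega>"
          using of_nat_mono[OF card_siblings_le_overlapping_pairs_1[OF \<omega>, of D K], where 'a = real]
          by (simp add: S_def y_def)
        moreover have "\<theta> * S \<le> 1 / 2 * S"
          using \<theta> by (intro mult_right_mono) (auto simp: S_def)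
        ultimately have "S \<le> 4 * y" using le by linarith
        then have "\<theta> * S \<le> \<theta> * (4 * y)"
          using \<theta> by (intro mult_left_mono) auto
        also have "\<dots> \<le> \<epsilon> * y"
          using \<theta> mult_right_mono[of "4 * \<theta>" \<epsilon> y] by (simp add: y_def mult_ac)
        finally have "x \<le> \<epsilon> * y" using x by simp
        then show ?thesis using \<epsilon> by (simp add: eq divide_le_eq y_def)
      qed
      show ?case
      proof (cases "S = 0")
        \<comment> \<open>Without sibling pairs the threshold in Markov's inequality would be zero,
          but then \<open>ratio\<close> applies to every matching.\<close>
        case True
        have "?Pr (\<lambda>\<omega>. \<epsilon> < \<bar>global_prob (R n) \<omega> - 0\<bar>) \<le> ?Pr (\<lambda>\<omega>. False)"
        proof (rule prob_random_matching_mono[OF balanced])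
          fix \<omega> assume \<omega>: "\<omega> \<in> matchings (R n)" and gt: "\<epsilon> < \<bar>global_prob (R n) \<omega> - 0\<bar>"
          have "siblings (R n) D = {}" using True by (simp add: S_def)
          then have "global_prob (R n) \<omega> \<le> \<epsilon>" by (intro ratio[OF \<omega>]) (simp add: S_def)
          moreover have "0 \<le> global_prob (R n) \<omega>"
            using global_prob_eq[of \<omega> "R n"] \<omega> support by simp
          ultimately show False using gt by simp
        qed
        then show ?thesis using \<zeta> by simp
      next
        case False
        then have S: "0 < S" by (simp add: S_def card_gt_0_iff)
        have t: "0 < \<theta> / 2 * S" using S \<theta> by simp
        have hr: "real (card (high_r (R n) K)) \<le> \<zeta> * \<theta> / 16 * h"
          using elim(3) num_r_le[of n] \<zeta> \<theta>
          by (smt (verit, best) h_def mult_left_mono mult_pos_pos of_nat_le_iff divide_pos_pos)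
        have "?Pr (\<lambda>\<omega>. \<epsilon> < \<bar>global_prob (R n) \<omega> - 0\<bar>)
            \<le> ?Pr (\<lambda>\<omega>. \<theta> / 2 * S \<le> ?col \<omega> \<or> \<theta> / 2 * S \<le> ?exc \<omega>)"
        proof (rule prob_random_matching_mono[OF balanced])
          fix \<omega> assume \<omega>: "\<omega> \<in> matchings (R n)" and gt: "\<epsilon> < \<bar>global_prob (R n) \<omega> - 0\<bar>"
          have "0 \<le> global_prob (R n) \<omega>"
            using global_prob_eq[of \<omega> "R n"] \<omega> support by simp
          with gt ratio[OF \<omega>] have "\<theta> * S < ?exc \<omega> + ?col \<omega>" by linarith
          then show "\<theta> / 2 * S \<le> ?col \<omega> \<or> \<theta> / 2 * S \<le> ?exc \<omega>" by linarith
        qed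
        also have "\<dots> \<le> ?Pr (\<lambda>\<omega>. \<theta> / 2 * S \<le> ?col \<omega>) + ?Pr (\<lambda>\<omega>. \<theta> / 2 * S \<le> ?exc \<omega>)"
          by (rule prob_disj_le)
        \<comment> \<open>A factor \<open>S\<close> occurs in the expectations and in the threshold
          and cancels, so the estimate holds however small \<open>S\<close> is compared with
          \<open>h\<close>.\<close>
        also have "\<dots> \<le> S * (8 * real D * real K / h + 16 * S * (real K)\<^sup>2 / h\<^sup>2) / (\<theta> / 2 * S)
            + S * (4 * real (card (high_r (R n) K)) / h + 4 * real K / h) / (\<theta> / 2 * S)"
          unfolding h_def S_def
          by (intro add_mono prob_card_collisions_ge[OF balanced h6 t[unfolded S_def]]
              prob_card_exceptional_ge[OF balanced h6 t[unfolded S_def]])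
        also have "\<dots> = 2 / \<theta> * (8 * real D * real K / h + 16 * S * (real K)\<^sup>2 / h\<^sup>2
            + (4 * (real (card (high_r (R n) K)) / h) + 4 * real K / h))"
          using S \<theta> by (simp add: field_simps)
        also have "\<dots> \<le> ?g h"
          using D_le S_le hr h \<theta>
          by (intro mult_left_mono add_mono divide_right_mono mult_right_mono order.refl)
             (auto simp: field_simps)
        also have "\<dots> < \<zeta>" using elim(1) by (simp add: h_def)
        finally show ?thesis by simp
      qed
    qed
  \<comment> \<open>The other half of \<open>order_tendstoI\<close> concerns negative lower bounds;
    probabilities are nonnegative.\<close>
  qed (auto intro!: always_eventually intro: less_le_trans[OF _ measure_nonneg])
qed

end

theorem theorem2p13:
  fixes \<H> :: "nat pair_pre_digraph set"
    and R :: "nat \<Rightarrow> rigc_params"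
    and P :: "'p measure" and Dl :: "'p \<Rightarrow> real"
    and \<mu> :: "nat pair_pre_digraph pmf"
  assumes H: "class_representatives \<H>"
    and R: "\<And>n. valid_params \<H> (R n)"
    and N: "filterlim (\<lambda>n. num_l (R n)) at_top sequentially"
    and M: "filterlim (\<lambda>n. num_r (R n)) at_top sequentially"
    and P: "prob_space P" and Dl: "Dl \<in> borel_measurable P"
    and A: "weak_conv_m
              (\<lambda>n. distr (measure_pmf (pmf_of_set (individuals (R n)))) borel
                      (\<lambda>v. real (ldeg (R n) v)))
              (distr P borel Dl)"
    and B: "integrable P Dl"
           "(\<lambda>n. measure_pmf.expectation (pmf_of_set (individuals (R n)))
                   (\<lambda>v. real (ldeg (R n) v)))
              \<longlonglongrightarrow> prob_space.expectation P Dl"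
    and C: "set_pmf \<mu> \<subseteq> \<H>"
           "\<And>H. H \<in> \<H> \<Longrightarrow>
              (\<lambda>n. real (card {a \<in> communities (R n). com (R n) a = H}) / real (num_r (R n)))
                \<longlonglongrightarrow> pmf \<mu> H"
    and D: "integrable (measure_pmf (map_pmf gsize \<mu>)) real"
           "(\<lambda>n. measure_pmf.expectation (pmf_of_set (communities (R n)))
                   (\<lambda>a. real (rdeg (R n) a)))
              \<longlonglongrightarrow> measure_pmf.expectation (map_pmf gsize \<mu>) real"
  shows "tendsto_in_prob (\<lambda>n. random_matching (R n)) (\<lambda>n. vertex_prob (R n)) 0 \<and>
    tendsto_in_prob (\<lambda>n. random_matching (R n)) (\<lambda>n. group_prob (R n)) 0 \<and>
    (integrable P (\<lambda>x. (Dl x)\<^sup>2) \<and>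
     (\<lambda>n. measure_pmf.expectation (pmf_of_set (individuals (R n)))
            (\<lambda>v. (real (ldeg (R n) v))\<^sup>2))
       \<longlonglongrightarrow> prob_space.expectation P (\<lambda>x. (Dl x)\<^sup>2)
     \<longrightarrow>
     (\<forall>n. \<forall>w\<in>set_pmf (random_matching (R n)).
        global_prob (R n) w =
          real (card (overlapping_pairs (R n) w 2)) / real (card (overlapping_pairs (R n) w 1))) \<and>
     tendsto_in_prob (\<lambda>n. random_matching (R n)) (\<lambda>n. global_prob (R n)) 0)"
proof -
  interpret P: prob_space P by fact
  \<comment> \<open>A nonempty vertex set gives every community a role, so that \<open>num_r\<close>
    is at most the number of half-edges.\<close>
  have sizes: "gsize (com (R n) a) \<ge> 1" if "a \<in> communities (R n)" for n a
  proof -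
    have "simple_connected_graph (com (R n) a)" "pverts (com (R n) a) = {1..gsize (com (R n) a)}"
      using H R[of n] that by (auto simp: class_representatives_def valid_params_def)
    then show ?thesis by (cases "gsize (com (R n) a)") (auto simp: simple_connected_graph_def)
  qed
  have balanced: "card (l_half_edges (R n)) = card (r_half_edges (R n))" for n
    using R[of n] by (simp add: card_half_edges valid_params_def)
  have num_l_le: "num_l (R n) \<le> card (l_half_edges (R n))" for n
    using sum_bounded_below[of "individuals (R n)" 1 "ldeg (R n)"] R[of n]
    by (simp add: card_half_edges valid_params_def individuals_def)
  have num_r_le: "num_r (R n) \<le> card (l_half_edges (R n))" for n
    using sum_bounded_below[of "communities (R n)" 1 "rdeg (R n)"] sizes[of _ n]
    unfolding balanced by (simp add: card_half_edges rdeg_def communities_def)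
  have l_mean: "measure_pmf.expectation (pmf_of_set (individuals (R n))) f
      = (\<Sum>v\<in>individuals (R n). f v) / real (num_l (R n))" if "1 \<le> num_l (R n)"
    for n and f :: "nat \<Rightarrow> real"
    using that by (subst integral_pmf_of_set) (auto simp: individuals_def)
  have r_mean: "measure_pmf.expectation (pmf_of_set (communities (R n))) f
      = (\<Sum>v\<in>communities (R n). f v) / real (num_r (R n))" if "1 \<le> num_r (R n)"
    for n and f :: "nat \<Rightarrow> real"
    using that by (subst integral_pmf_of_set) (auto simp: communities_def)
  have N1: "\<forall>\<^sub>F n in sequentially. 1 \<le> num_l (R n)" and M1: "\<forall>\<^sub>F n in sequentially. 1 \<le> num_r (R n)"
    using N M by (auto simp: filterlim_at_top)
  \<comment> \<open>Convergent means are eventually below \<open>\<bar>L\<bar> + 1\<close>, which is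
    positive for any limit. Applied to the degrees and, for the global perspective, to their
    squares.\<close>
  have l_bound: "\<exists>B>0. \<forall>\<^sub>F n in sequentially.
      (\<Sum>v\<in>individuals (R n). f n v) \<le> B * real (num_l (R n))"
    if lim: "(\<lambda>n. measure_pmf.expectation (pmf_of_set (individuals (R n))) (f n)) \<longlonglongrightarrow> L"
    for f :: "nat \<Rightarrow> nat \<Rightarrow> real" and L
  proof (intro exI conjI)
    have L: "L < \<bar>L\<bar> + 1" by simp
    show "\<forall>\<^sub>F n in sequentially. (\<Sum>v\<in>individuals (R n). f n v) \<le> (\<bar>L\<bar> + 1) * real (num_l (R n))"
      using order_tendstoD(2)[OF lim L] N1
      by eventually_elim (simp add: l_mean divide_less_eq)
  qed simp
  have r_bound: "\<exists>B>0. \<forall>\<^sub>F n in sequentially.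
      (\<Sum>v\<in>communities (R n). f n v) \<le> B * real (num_r (R n))"
    if lim: "(\<lambda>n. measure_pmf.expectation (pmf_of_set (communities (R n))) (f n)) \<longlonglongrightarrow> L"
    for f :: "nat \<Rightarrow> nat \<Rightarrow> real" and L
  proof (intro exI conjI)
    have L: "L < \<bar>L\<bar> + 1" by simp
    show "\<forall>\<^sub>F n in sequentially. (\<Sum>v\<in>communities (R n). f n v) \<le> (\<bar>L\<bar> + 1) * real (num_r (R n))"
      using order_tendstoD(2)[OF lim L] M1
      by eventually_elim (simp add: r_mean divide_less_eq)
  qed simp
  interpret rigc_sequence R
  proof
    show "\<exists>B>0. \<forall>\<^sub>F n in sequentially. real (card (l_half_edges (R n))) \<le> B * real (num_l (R n))"
      using l_bound[OF B(2)] by (simp add: card_half_edges)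
    show "\<exists>B>0. \<forall>\<^sub>F n in sequentially. real (card (l_half_edges (R n))) \<le> B * real (num_r (R n))"
      using r_bound[OF D(2)] unfolding balanced by (simp add: card_half_edges)
    show "\<exists>D. \<forall>\<^sub>F n in sequentially. real (card (high_l (R n) D)) \<le> e * real (num_l (R n))"
      if "0 < e" for e
      by (rule high_l_tail[OF N P Dl A B that])
    show "\<exists>K. \<forall>\<^sub>F n in sequentially. real (card (high_r (R n) K)) \<le> e * real (num_r (R n))"
      if "0 < e" for e
      by (rule high_r_tail[OF M C D that])
  qed (fact balanced num_l_le num_r_le N M)+
  show ?thesis
  proof (intro conjI impI vertex_prob_tendsto group_prob_tendsto allI ballI)
    fix n w assume "w \<in> set_pmf (random_matching (R n))"
    then show "global_prob (R n) w =
        real (card (overlapping_pairs (R n) w 2)) / real (card (overlapping_pairs (R n) w 1))"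
      by (rule global_prob_eq)
  next
    assume "integrable P (\<lambda>x. (Dl x)\<^sup>2) \<and>
      (\<lambda>n. measure_pmf.expectation (pmf_of_set (individuals (R n))) (\<lambda>v. (real (ldeg (R n) v))\<^sup>2))
        \<longlonglongrightarrow> prob_space.expectation P (\<lambda>x. (Dl x)\<^sup>2)"
    then obtain B' where "0 < B'" "\<forall>\<^sub>F n in sequentially.
        (\<Sum>v\<in>individuals (R n). (real (ldeg (R n) v))\<^sup>2) \<le> B' * real (num_l (R n))"
      using l_bound[of "\<lambda>n v. (real (ldeg (R n) v))\<^sup>2"] by auto
    then show "tendsto_in_prob (\<lambda>n. random_matching (R n)) (\<lambda>n. global_prob (R n)) 0"
      by (intro global_prob_tendsto)
  qed
qed

end
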